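(* Let $(M,m,V,\varkappa)$ be a mechanical system with gyroscopic forces with $\dim M=2$. Let $h\in\mathbf{R}$ be such that $M_h=\{x\in M:V(x)<h\}$ is non-empty, let $m_h=2(h-V)m$ be the corresponding Riemannian metric on $M_h$, and let $o_h$ be the volume (area) form of $m_h$. Let $x(t)$ be a curve in $M_h$ satisfying $\frac12\langle x'(t),x'(t)\rangle+V(x(t))=h$. Then $x(t)$ is a motion in the system $(M,m,V,\varkappa)$ if and only if, being parameterized (in the same direction) by the arclength of the metric $m_h$, it has at each of its points the geodesic curvature (with respect to $m_h$) equal to $|\varkappa/o_h|$, and, at points where $\varkappa\neq0$, the basis $\{$the curvature vector, the tangent vector$\}$ of $T_{x(t)}(M)$ gives the same orientation of $T_{x(t)}(M)$ as the form $\varkappa$.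
   Context: A mechanical system with gyroscopic forces is a 4-tuple $(M,m,V,\varkappa)$, where $M$ is a smooth manifold, $m=\langle\cdot,\cdot\rangle$ a smooth Riemannian metric on $M$, $V$ a smooth function on $M$ and $\varkappa$ a smooth closed 2-form on $M$. Let $p_M:T(M)\to M$ be the tangent bundle projection and $K(w)=\frac12\langle w,w\rangle$ for $w\in T(M)$. The Lagrange forms generated by $m$ are the 1-form $\theta$ on $T(M)$ with $\theta_w(Y)=\langle w,Tp_M(Y)\rangle$ for $Y\in T_w(T(M))$, and the 2-form $\sigma=\mathrm{d}\theta$. The dynamical system corresponding to $(M,m,V,\varkappa)$ is the unique vector field $X$ on $T(M)$ such that $\mathrm{i}_X(\sigma+p_M^*\varkappa)=-\mathrm{d}(K+V\circ p_M)$; it satisfies $Tp_M\circ X=\mathrm{id}_{T(M)}$. A motion in the system is a curve $x(t)=p_M(w(t))$, where $w(t)$ is an integral curve of $X$ (then $w(t)=x'(t)$). When $\dim M=2$, write $\varkappa=k_ho_h$; then $\varkappa/o_h$ denotes the function $k_h$. Since only $|\varkappa/o_h|=|k_h|$ is used, $o_h$ may be taken locally, with either sign. For a curve $\overline{x}(\tau)$ parameterized by the arclength $\tau$ of $m_h$, the tangent vector is $d\overline{x}/d\tau$, the curvature vector is $\frac{D}{d\tau}\frac{d\overline{x}}{d\tau}$ (covariant derivative of the Levi-Civita connection of $m_h$), and the geodesic curvature is the $m_h$-length of the curvature vector. A basis $\{a,b\}$ of $T_x(M)$ gives the same orientation as $\varkappa$ if $\varkappa(a,b)>0$. *)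

theory Defs
  imports "HOL-Analysis.Analysis"
begin

section \<open>Smooth maps between Euclidean spaces\<close>

text \<open>Only meaningful for open \<open>S\<close>: the derivatives are two-sided.\<close>

primrec times_differentiable_on ::
    "nat \<Rightarrow> ('e::euclidean_space \<Rightarrow> 'f::real_normed_vector) \<Rightarrow> 'e set \<Rightarrow> bool" where
  "times_differentiable_on 0 f S \<longleftrightarrow> continuous_on S f"
| "times_differentiable_on (Suc k) f S \<longleftrightarrow>
     (\<forall>x\<in>S. f differentiable (at x)) \<and>
     (\<forall>v. times_differentiable_on k (\<lambda>x. frechet_derivative f (at x) v) S)"

definition smooth_on :: "'e::euclidean_space set \<Rightarrow> ('e \<Rightarrow> 'f::real_normed_vector) \<Rightarrow> bool" where
  "smooth_on S f \<longleftrightarrow> (\<forall>k. times_differentiable_on k f S)"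

section \<open>Smooth manifolds\<close>

text \<open>
  A manifold is given by an atlas. A chart is a pair of its domain and its coordinate map, whose
  values outside the domain are irrelevant. The topology is the one induced by the atlas.
\<close>

type_synonym ('p, 'e) chart = "'p set \<times> ('p \<Rightarrow> 'e)"

definition chart_inv :: "('p, 'e) chart \<Rightarrow> 'e \<Rightarrow> 'p" where
  "chart_inv c = inv_into (fst c) (snd c)"

definition transition :: "('p, 'e) chart \<Rightarrow> ('p, 'e) chart \<Rightarrow> 'e \<Rightarrow> 'e" where
  "transition c d = snd d \<circ> chart_inv c"

definition points :: "('p, 'e) chart set \<Rightarrow> 'p set" where
  "points A = (\<Union>c\<in>A. fst c)"

definition atlas_open :: "('p, 'e::euclidean_space) chart set \<Rightarrow> 'p set \<Rightarrow> bool" where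
  "atlas_open A W \<longleftrightarrow> W \<subseteq> points A \<and> (\<forall>c\<in>A. open (snd c ` (W \<inter> fst c)))"

definition smooth_atlas :: "('p, 'e::euclidean_space) chart set \<Rightarrow> bool" where
  "smooth_atlas A \<longleftrightarrow>
     (\<forall>c\<in>A. inj_on (snd c) (fst c)) \<and>
     (\<forall>c\<in>A. \<forall>d\<in>A. open (snd c ` (fst c \<inter> fst d)) \<and>
        smooth_on (snd c ` (fst c \<inter> fst d)) (transition c d))"

definition smooth_manifold :: "('p, 'e::euclidean_space) chart set \<Rightarrow> bool" where
  "smooth_manifold A \<longleftrightarrow> smooth_atlas A \<and>
     Hausdorff_space (topology (atlas_open A)) \<and> second_countable (topology (atlas_open A))"

lemma openin_atlas_topology:
  assumes "smooth_atlas A"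
  shows "openin (topology (atlas_open A)) = atlas_open A"
proof -
  have "istopology (atlas_open A)"
    unfolding istopology_def
  proof (intro conjI allI impI)
    fix S T assume S: "atlas_open A S" and T: "atlas_open A T"
    show "atlas_open A (S \<inter> T)"
      unfolding atlas_open_def
    proof (intro conjI ballI)
      show "S \<inter> T \<subseteq> points A" using S by (auto simp: atlas_open_def)
      fix c assume c: "c \<in> A"
      then have "inj_on (snd c) (fst c)" using assms by (auto simp: smooth_atlas_def)
      then have "snd c ` (S \<inter> T \<inter> fst c) = snd c ` (S \<inter> fst c) \<inter> snd c ` (T \<inter> fst c)"
        by (auto simp: inj_on_def)
      then show "open (snd c ` (S \<inter> T \<inter> fst c))"
        using S T c by (auto simp: atlas_open_def)
    qed
  next
    fix K assume K: "\<forall>S\<in>K. atlas_open A S"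
    show "atlas_open A (\<Union>K)"
      unfolding atlas_open_def
    proof (intro conjI ballI)
      show "\<Union>K \<subseteq> points A" using K by (auto simp: atlas_open_def)
      fix c assume c: "c \<in> A"
      have "snd c ` (\<Union>K \<inter> fst c) = (\<Union>S\<in>K. snd c ` (S \<inter> fst c))" by auto
      then show "open (snd c ` (\<Union>K \<inter> fst c))"
        using K c by (auto simp: atlas_open_def)
    qed
  qed
  then show ?thesis by (rule topology_inverse')
qed

text \<open>
  Definitions below that mention \<open>chart_at\<close> are coordinate formulas whose value does not
  depend on the chart.
\<close>

definition chart_at :: "('p, 'e) chart set \<Rightarrow> 'p \<Rightarrow> ('p, 'e) chart" where
  "chart_at A p = (SOME c. c \<in> A \<and> p \<in> fst c)"

section \<open>Tangent vectors\<close>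

text \<open>
  A tangent vector at \<open>p\<close> is the family of its coordinate vectors in all charts around \<open>p\<close>,
  related by the Jacobians of the transition maps; it is set to zero on all other charts.
\<close>

type_synonym ('p, 'e) tvec = "('p, 'e) chart \<Rightarrow> 'e"

definition tangent_space ::
    "('p, 'e::euclidean_space) chart set \<Rightarrow> 'p \<Rightarrow> ('p, 'e) tvec set" where
  "tangent_space A p = {\<xi>.
     (\<forall>c\<in>A. \<forall>d\<in>A. p \<in> fst c \<longrightarrow> p \<in> fst d \<longrightarrow>
        \<xi> d = frechet_derivative (transition c d) (at (snd c p)) (\<xi> c)) \<and>
     (\<forall>c. \<not> (c \<in> A \<and> p \<in> fst c) \<longrightarrow> \<xi> c = 0)}"

text \<open>The tangent vector at \<open>p\<close> with coordinate vector \<open>u\<close> in the chart \<open>c\<close>.\<close>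

definition coord_vector ::
    "('p, 'e::euclidean_space) chart set \<Rightarrow> ('p, 'e) chart \<Rightarrow> 'p \<Rightarrow> 'e \<Rightarrow> ('p, 'e) tvec" where
  "coord_vector A c p u = (\<lambda>d. if d \<in> A \<and> p \<in> fst d
     then frechet_derivative (transition c d) (at (snd c p)) u else 0)"

definition tangent_bundle ::
    "('p, 'e::euclidean_space) chart set \<Rightarrow> ('p \<times> ('p, 'e) tvec) set" where
  "tangent_bundle A = Sigma (points A) (tangent_space A)"

definition tangent_chart ::
    "('p, 'e::euclidean_space) chart set \<Rightarrow> ('p, 'e) chart \<Rightarrow> ('p \<times> ('p, 'e) tvec, 'e \<times> 'e) chart" where
  "tangent_chart A c =
     ({w \<in> tangent_bundle A. fst w \<in> fst c}, \<lambda>w. (snd c (fst w), snd w c))"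

definition tangent_atlas ::
    "('p, 'e::euclidean_space) chart set \<Rightarrow> ('p \<times> ('p, 'e) tvec, 'e \<times> 'e) chart set" where
  "tangent_atlas A = tangent_chart A ` A"

definition differential ::
    "('p, 'e::euclidean_space) chart set \<Rightarrow> ('q, 'f::euclidean_space) chart set \<Rightarrow> ('p \<Rightarrow> 'q) \<Rightarrow>
     'p \<Rightarrow> ('p, 'e) tvec \<Rightarrow> ('q, 'f) tvec" where
  "differential A B f p \<xi> = (\<lambda>d. if d \<in> B \<and> f p \<in> fst d
     then (let c = chart_at A p in
       frechet_derivative (snd d \<circ> f \<circ> chart_inv c) (at (snd c p)) (\<xi> c))
     else 0)"

section \<open>Functions, forms and metrics\<close>

text \<open>
  A 1-form maps a point and a tangent vector there to a real number; 2-forms and metrics take two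
  tangent vectors. Values on other arguments are irrelevant.
\<close>

definition smooth_function ::
    "('p, 'e::euclidean_space) chart set \<Rightarrow> ('p \<Rightarrow> real) \<Rightarrow> bool" where
  "smooth_function A f \<longleftrightarrow> (\<forall>c\<in>A. smooth_on (snd c ` fst c) (f \<circ> chart_inv c))"

definition function_differential ::
    "('p, 'e::euclidean_space) chart set \<Rightarrow> ('p \<Rightarrow> real) \<Rightarrow> 'p \<Rightarrow> ('p, 'e) tvec \<Rightarrow> real" where
  "function_differential A f p \<xi> = (let c = chart_at A p in
     frechet_derivative (f \<circ> chart_inv c) (at (snd c p)) (\<xi> c))"

definition coord_1form ::
    "('p, 'e::euclidean_space) chart set \<Rightarrow> ('p \<Rightarrow> ('p, 'e) tvec \<Rightarrow> real) \<Rightarrow> ('p, 'e) chart \<Rightarrow>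
     'e \<Rightarrow> 'e \<Rightarrow> real" where
  "coord_1form A \<alpha> c q u = \<alpha> (chart_inv c q) (coord_vector A c (chart_inv c q) u)"

definition coord_2tensor ::
    "('p, 'e::euclidean_space) chart set \<Rightarrow> ('p \<Rightarrow> ('p, 'e) tvec \<Rightarrow> ('p, 'e) tvec \<Rightarrow> real) \<Rightarrow>
     ('p, 'e) chart \<Rightarrow> 'e \<Rightarrow> 'e \<Rightarrow> 'e \<Rightarrow> real" where
  "coord_2tensor A \<beta> c q u v = \<beta> (chart_inv c q)
     (coord_vector A c (chart_inv c q) u) (coord_vector A c (chart_inv c q) v)"

definition smooth_2tensor ::
    "('p, 'e::euclidean_space) chart set \<Rightarrow>
     ('p \<Rightarrow> ('p, 'e) tvec \<Rightarrow> ('p, 'e) tvec \<Rightarrow> real) \<Rightarrow> bool" where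
  "smooth_2tensor A \<beta> \<longleftrightarrow> (\<forall>c\<in>A.
     (\<forall>q\<in>snd c ` fst c. bilinear (coord_2tensor A \<beta> c q)) \<and>
     (\<forall>u v. smooth_on (snd c ` fst c) (\<lambda>q. coord_2tensor A \<beta> c q u v)))"

definition riemannian_metric ::
    "('p, 'e::euclidean_space) chart set \<Rightarrow>
     ('p \<Rightarrow> ('p, 'e) tvec \<Rightarrow> ('p, 'e) tvec \<Rightarrow> real) \<Rightarrow> bool" where
  "riemannian_metric A g \<longleftrightarrow> smooth_2tensor A g \<and>
     (\<forall>p\<in>points A. \<forall>\<xi>\<in>tangent_space A p.
        (\<forall>\<eta>\<in>tangent_space A p. g p \<xi> \<eta> = g p \<eta> \<xi>) \<and>
        (\<xi> \<noteq> (\<lambda>_. 0) \<longrightarrow> g p \<xi> \<xi> > 0))"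

text \<open>
  The exterior derivative uses the convention
  \<open>d\<alpha>(Y,Z) = Y(\<alpha>(Z)) - Z(\<alpha>(Y)) - \<alpha>([Y,Z])\<close>, without a factor 1/2. This is the one for which the
  field defined below satisfies \<open>Tp\<^sub>M \<circ> X = id\<close>.
\<close>

definition ext_deriv ::
    "('p, 'e::euclidean_space) chart set \<Rightarrow> ('p \<Rightarrow> ('p, 'e) tvec \<Rightarrow> real) \<Rightarrow>
     'p \<Rightarrow> ('p, 'e) tvec \<Rightarrow> ('p, 'e) tvec \<Rightarrow> real" where
  "ext_deriv A \<alpha> p \<xi> \<eta> = (let c = chart_at A p in
     frechet_derivative (\<lambda>q. coord_1form A \<alpha> c q (\<eta> c)) (at (snd c p)) (\<xi> c) -
     frechet_derivative (\<lambda>q. coord_1form A \<alpha> c q (\<xi> c)) (at (snd c p)) (\<eta> c))"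

definition smooth_closed_2form ::
    "('p, 'e::euclidean_space) chart set \<Rightarrow>
     ('p \<Rightarrow> ('p, 'e) tvec \<Rightarrow> ('p, 'e) tvec \<Rightarrow> real) \<Rightarrow> bool" where
  "smooth_closed_2form A \<beta> \<longleftrightarrow> smooth_2tensor A \<beta> \<and>
     (\<forall>p\<in>points A. \<forall>\<xi>\<in>tangent_space A p. \<beta> p \<xi> \<xi> = 0) \<and>
     (\<forall>c\<in>A. \<forall>q\<in>snd c ` fst c. \<forall>u v z.
        frechet_derivative (\<lambda>q. coord_2tensor A \<beta> c q v z) (at q) u +
        frechet_derivative (\<lambda>q. coord_2tensor A \<beta> c q z u) (at q) v +
        frechet_derivative (\<lambda>q. coord_2tensor A \<beta> c q u v) (at q) z = 0)"

definition pullback_2form ::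
    "('p, 'e::euclidean_space) chart set \<Rightarrow> ('q, 'f::euclidean_space) chart set \<Rightarrow> ('p \<Rightarrow> 'q) \<Rightarrow>
     ('q \<Rightarrow> ('q, 'f) tvec \<Rightarrow> ('q, 'f) tvec \<Rightarrow> real) \<Rightarrow>
     'p \<Rightarrow> ('p, 'e) tvec \<Rightarrow> ('p, 'e) tvec \<Rightarrow> real" where
  "pullback_2form A B f \<beta> p \<xi> \<eta> = \<beta> (f p) (differential A B f p \<xi>) (differential A B f p \<eta>)"

section \<open>Curves\<close>

definition smooth_curve ::
    "('p, 'e::euclidean_space) chart set \<Rightarrow> real set \<Rightarrow> (real \<Rightarrow> 'p) \<Rightarrow> bool" where
  "smooth_curve A J x \<longleftrightarrow> (\<forall>t\<in>J. \<exists>c\<in>A. \<exists>e>0.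
     ball t e \<subseteq> J \<and> x ` ball t e \<subseteq> fst c \<and> smooth_on (ball t e) (snd c \<circ> x))"

definition velocity ::
    "('p, 'e::euclidean_space) chart set \<Rightarrow> (real \<Rightarrow> 'p) \<Rightarrow> real \<Rightarrow> ('p, 'e) tvec" where
  "velocity A x t = (\<lambda>c. if c \<in> A \<and> x t \<in> fst c
     then vector_derivative (snd c \<circ> x) (at t) else 0)"

definition integral_curve ::
    "('p, 'e::euclidean_space) chart set \<Rightarrow> ('p \<Rightarrow> ('p, 'e) tvec) \<Rightarrow> real set \<Rightarrow> (real \<Rightarrow> 'p) \<Rightarrow> bool" where
  "integral_curve A X J w \<longleftrightarrow> smooth_curve A J w \<and> (\<forall>t\<in>J. velocity A w t = X (w t))"

section \<open>Mechanical systems with gyroscopic forces\<close>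

definition gyroscopic_system ::
    "('p, 'e::euclidean_space) chart set \<Rightarrow> ('p \<Rightarrow> ('p, 'e) tvec \<Rightarrow> ('p, 'e) tvec \<Rightarrow> real) \<Rightarrow>
     ('p \<Rightarrow> real) \<Rightarrow> ('p \<Rightarrow> ('p, 'e) tvec \<Rightarrow> ('p, 'e) tvec \<Rightarrow> real) \<Rightarrow> bool" where
  "gyroscopic_system A m V \<kappa> \<longleftrightarrow> smooth_manifold A \<and> riemannian_metric A m \<and>
     smooth_function A V \<and> smooth_closed_2form A \<kappa>"

definition kinetic_energy ::
    "('p \<Rightarrow> ('p, 'e) tvec \<Rightarrow> ('p, 'e) tvec \<Rightarrow> real) \<Rightarrow> 'p \<times> ('p, 'e) tvec \<Rightarrow> real" where
  "kinetic_energy m w = 1/2 * m (fst w) (snd w) (snd w)"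

definition lagrange_1form ::
    "('p, 'e::euclidean_space) chart set \<Rightarrow> ('p \<Rightarrow> ('p, 'e) tvec \<Rightarrow> ('p, 'e) tvec \<Rightarrow> real) \<Rightarrow>
     'p \<times> ('p, 'e) tvec \<Rightarrow> ('p \<times> ('p, 'e) tvec, 'e \<times> 'e) tvec \<Rightarrow> real" where
  "lagrange_1form A m w Y =
     m (fst w) (snd w) (differential (tangent_atlas A) A fst w Y)"

definition lagrange_2form ::
    "('p, 'e::euclidean_space) chart set \<Rightarrow> ('p \<Rightarrow> ('p, 'e) tvec \<Rightarrow> ('p, 'e) tvec \<Rightarrow> real) \<Rightarrow>
     'p \<times> ('p, 'e) tvec \<Rightarrow> ('p \<times> ('p, 'e) tvec, 'e \<times> 'e) tvec \<Rightarrow>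
     ('p \<times> ('p, 'e) tvec, 'e \<times> 'e) tvec \<Rightarrow> real" where
  "lagrange_2form A m = ext_deriv (tangent_atlas A) (lagrange_1form A m)"

text \<open>
  The equation \<open>i\<^sub>X(\<sigma> + p\<^sub>M\<^sup>*\<kappa>) = -d(K + V \<circ> p\<^sub>M)\<close> is algebraic in \<open>X\<close> at each point, so the unique
  vector field solving it is obtained by taking the unique solution at each point.
\<close>

definition dynamical_field ::
    "('p, 'e::euclidean_space) chart set \<Rightarrow> ('p \<Rightarrow> ('p, 'e) tvec \<Rightarrow> ('p, 'e) tvec \<Rightarrow> real) \<Rightarrow>
     ('p \<Rightarrow> real) \<Rightarrow> ('p \<Rightarrow> ('p, 'e) tvec \<Rightarrow> ('p, 'e) tvec \<Rightarrow> real) \<Rightarrow>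
     'p \<times> ('p, 'e) tvec \<Rightarrow> ('p \<times> ('p, 'e) tvec, 'e \<times> 'e) tvec" where
  "dynamical_field A m V \<kappa> w = (THE Y. Y \<in> tangent_space (tangent_atlas A) w \<and>
     (\<forall>Z\<in>tangent_space (tangent_atlas A) w.
        lagrange_2form A m w Y Z + pullback_2form (tangent_atlas A) A fst \<kappa> w Y Z =
        - function_differential (tangent_atlas A) (\<lambda>w. kinetic_energy m w + V (fst w)) w Z))"

definition motion ::
    "('p, 'e::euclidean_space) chart set \<Rightarrow> ('p \<Rightarrow> ('p, 'e) tvec \<Rightarrow> ('p, 'e) tvec \<Rightarrow> real) \<Rightarrow>
     ('p \<Rightarrow> real) \<Rightarrow> ('p \<Rightarrow> ('p, 'e) tvec \<Rightarrow> ('p, 'e) tvec \<Rightarrow> real) \<Rightarrow>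
     real set \<Rightarrow> (real \<Rightarrow> 'p) \<Rightarrow> bool" where
  "motion A m V \<kappa> J x \<longleftrightarrow>
     (\<exists>w. integral_curve (tangent_atlas A) (dynamical_field A m V \<kappa>) J w \<and>
          (\<forall>t\<in>J. x t = fst (w t)))"

section \<open>Curvature of curves in a Riemannian metric\<close>

text \<open>
  All notions here are local in the metric, so they apply to a metric defined on an open
  subset of the manifold.
\<close>

definition metric_norm ::
    "('p \<Rightarrow> ('p, 'e) tvec \<Rightarrow> ('p, 'e) tvec \<Rightarrow> real) \<Rightarrow> 'p \<Rightarrow> ('p, 'e) tvec \<Rightarrow> real" where
  "metric_norm g p \<xi> = sqrt (g p \<xi> \<xi>)"

text \<open>
  The vector \<open>\<Gamma>\<^sup>k\<^sub>i\<^sub>j u\<^sup>i v\<^sup>j\<close> of the Levi-Civita connection, characterized by the Koszul formula for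
  coordinate (commuting) fields.
\<close>

definition christoffel ::
    "('p, 'e::euclidean_space) chart set \<Rightarrow> ('p \<Rightarrow> ('p, 'e) tvec \<Rightarrow> ('p, 'e) tvec \<Rightarrow> real) \<Rightarrow>
     ('p, 'e) chart \<Rightarrow> 'e \<Rightarrow> 'e \<Rightarrow> 'e \<Rightarrow> 'e" where
  "christoffel A g c q u v = (THE z. \<forall>y. 2 * coord_2tensor A g c q z y =
     frechet_derivative (\<lambda>q. coord_2tensor A g c q v y) (at q) u +
     frechet_derivative (\<lambda>q. coord_2tensor A g c q u y) (at q) v -
     frechet_derivative (\<lambda>q. coord_2tensor A g c q u v) (at q) y)"

text \<open>Covariant derivative of a vector field \<open>W\<close> along the curve \<open>y\<close>.\<close>

definition covariant_derivative ::
    "('p, 'e::euclidean_space) chart set \<Rightarrow> ('p \<Rightarrow> ('p, 'e) tvec \<Rightarrow> ('p, 'e) tvec \<Rightarrow> real) \<Rightarrow>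
     (real \<Rightarrow> 'p) \<Rightarrow> (real \<Rightarrow> ('p, 'e) tvec) \<Rightarrow> real \<Rightarrow> ('p, 'e) tvec" where
  "covariant_derivative A g y W \<tau> = (let c = chart_at A (y \<tau>) in
     coord_vector A c (y \<tau>)
       (vector_derivative (\<lambda>s. W s c) (at \<tau>) +
        christoffel A g c (snd c (y \<tau>)) (velocity A y \<tau> c) (W \<tau> c)))"

definition curvature_vector ::
    "('p, 'e::euclidean_space) chart set \<Rightarrow> ('p \<Rightarrow> ('p, 'e) tvec \<Rightarrow> ('p, 'e) tvec \<Rightarrow> real) \<Rightarrow>
     (real \<Rightarrow> 'p) \<Rightarrow> real \<Rightarrow> ('p, 'e) tvec" where
  "curvature_vector A g y = covariant_derivative A g y (velocity A y)"

definition geodesic_curvature ::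
    "('p, 'e::euclidean_space) chart set \<Rightarrow> ('p \<Rightarrow> ('p, 'e) tvec \<Rightarrow> ('p, 'e) tvec \<Rightarrow> real) \<Rightarrow>
     (real \<Rightarrow> 'p) \<Rightarrow> real \<Rightarrow> real" where
  "geodesic_curvature A g y \<tau> = metric_norm g (y \<tau>) (curvature_vector A g y \<tau>)"

text \<open>Arclength measured from the parameter value \<open>a\<close>; negative before \<open>a\<close>.\<close>

definition arclength ::
    "('p, 'e::euclidean_space) chart set \<Rightarrow> ('p \<Rightarrow> ('p, 'e) tvec \<Rightarrow> ('p, 'e) tvec \<Rightarrow> real) \<Rightarrow>
     (real \<Rightarrow> 'p) \<Rightarrow> real \<Rightarrow> real \<Rightarrow> real" where
  "arclength A g x a t = (LBINT u=a..t. metric_norm g (x u) (velocity A x u))"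

text \<open>The curve \<open>x\<close> on \<open>J\<close>, parameterized in the same direction by the arclength from \<open>a\<close>.\<close>

definition by_arclength ::
    "('p, 'e::euclidean_space) chart set \<Rightarrow> ('p \<Rightarrow> ('p, 'e) tvec \<Rightarrow> ('p, 'e) tvec \<Rightarrow> real) \<Rightarrow>
     real set \<Rightarrow> (real \<Rightarrow> 'p) \<Rightarrow> real \<Rightarrow> real \<Rightarrow> 'p" where
  "by_arclength A g J x a \<tau> = x (inv_into J (arclength A g x a) \<tau>)"

section \<open>Area forms in dimension two\<close>

text \<open>
  \<open>\<omega>\<close> is one of the two area forms of \<open>g\<close> on the tangent plane at \<open>p\<close>, differing by sign.
\<close>

definition area_form_at ::
    "('p, real^2) chart set \<Rightarrow> ('p \<Rightarrow> ('p, real^2) tvec \<Rightarrow> ('p, real^2) tvec \<Rightarrow> real) \<Rightarrow> 'p \<Rightarrow>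
     (('p, real^2) tvec \<Rightarrow> ('p, real^2) tvec \<Rightarrow> real) \<Rightarrow> bool" where
  "area_form_at A g p \<omega> \<longleftrightarrow>
     (\<forall>c\<in>A. p \<in> fst c \<longrightarrow> bilinear (\<lambda>u v. \<omega> (coord_vector A c p u) (coord_vector A c p v))) \<and>
     (\<forall>\<xi>\<in>tangent_space A p. \<omega> \<xi> \<xi> = 0) \<and>
     (\<forall>\<xi>\<in>tangent_space A p. \<forall>\<eta>\<in>tangent_space A p.
        g p \<xi> \<xi> = 1 \<and> g p \<eta> \<eta> = 1 \<and> g p \<xi> \<eta> = 0 \<longrightarrow> \<bar>\<omega> \<xi> \<eta>\<bar> = 1)"

text \<open>The number \<open>\<bar>\<kappa>/o\<bar>\<close> at \<open>p\<close>, where \<open>o\<close> is the area form of \<open>g\<close>.\<close>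

definition abs_form_ratio ::
    "('p, real^2) chart set \<Rightarrow> ('p \<Rightarrow> ('p, real^2) tvec \<Rightarrow> ('p, real^2) tvec \<Rightarrow> real) \<Rightarrow>
     ('p \<Rightarrow> ('p, real^2) tvec \<Rightarrow> ('p, real^2) tvec \<Rightarrow> real) \<Rightarrow> 'p \<Rightarrow> real" where
  "abs_form_ratio A g \<kappa> p = (THE r. \<exists>\<omega> k. area_form_at A g p \<omega> \<and>
     (\<forall>\<xi>\<in>tangent_space A p. \<forall>\<eta>\<in>tangent_space A p. \<kappa> p \<xi> \<eta> = k * \<omega> \<xi> \<eta>) \<and> r = \<bar>k\<bar>)"

definition nonzero_form_at ::
    "('p, 'e::euclidean_space) chart set \<Rightarrow> ('p \<Rightarrow> ('p, 'e) tvec \<Rightarrow> ('p, 'e) tvec \<Rightarrow> real) \<Rightarrow>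
     'p \<Rightarrow> bool" where
  "nonzero_form_at A \<kappa> p \<longleftrightarrow> (\<exists>\<xi>\<in>tangent_space A p. \<exists>\<eta>\<in>tangent_space A p. \<kappa> p \<xi> \<eta> \<noteq> 0)"

text \<open>
  Since \<open>\<kappa>\<close> is alternating and the dimension is two, the inequality already forces \<open>{\<xi>, \<eta>}\<close> to be
  a basis of the tangent plane.
\<close>

definition same_orientation ::
    "('p \<Rightarrow> ('p, 'e) tvec \<Rightarrow> ('p, 'e) tvec \<Rightarrow> real) \<Rightarrow> 'p \<Rightarrow>
     ('p, 'e) tvec \<Rightarrow> ('p, 'e) tvec \<Rightarrow> bool" where
  "same_orientation \<kappa> p \<xi> \<eta> \<longleftrightarrow> \<kappa> p \<xi> \<eta> > 0"

section \<open>The metric of a fixed energy level\<close>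

text \<open>Riemannian only on the region \<open>V < h\<close>.\<close>

definition jacobi_metric ::
    "('p \<Rightarrow> ('p, 'e) tvec \<Rightarrow> ('p, 'e) tvec \<Rightarrow> real) \<Rightarrow> ('p \<Rightarrow> real) \<Rightarrow> real \<Rightarrow>
     'p \<Rightarrow> ('p, 'e) tvec \<Rightarrow> ('p, 'e) tvec \<Rightarrow> real" where
  "jacobi_metric m V h p \<xi> \<eta> = 2 * (h - V p) * m p \<xi> \<eta>"

definition energy_region :: "('p, 'e) chart set \<Rightarrow> ('p \<Rightarrow> real) \<Rightarrow> real \<Rightarrow> 'p set" where
  "energy_region A V h = {p \<in> points A. V p < h}"

end

theory Submission
  imports Defs
begin

text \<open>
  Write \<open>E(z) = \<langle>\<nabla>\<^sub>t x', z\<rangle> + dV(z)\<close> for the Euler-Lagrange covector of a curve \<open>x\<close>.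

  Testing the equation \<open>i\<^sub>X(\<sigma> + p\<^sub>M\<^sup>*\<kappa>) = -d(K + V \<circ> p\<^sub>M)\<close> in a chart of the tangent bundle against vertical
  vectors gives \<open>Tp\<^sub>M \<circ> X = id\<close>, and against the remaining ones it gives Newton's equation
  \<open>E(z) = -\<kappa>(x', z)\<close> for all \<open>z\<close> (\<open>dynamical_field_iff_newton\<close>, \<open>motion_iff_newton\<close>). The chart in
  which the field is computed and the one in which the curvature is computed may differ, so the
  equation has to be carried from one chart to another; this is where the symmetry of second
  derivatives of transition maps enters (\<open>geodesic_covector_change\<close>).

  On the energy level \<open>h\<close> the function \<open>f = 2(h - V)\<close> is at once the square of the speed for \<open>m\<close>, the
  conformal factor of \<open>m\<^sub>h\<close>, and hence the speed for \<open>m\<^sub>h\<close>. Dividing the velocity by \<open>f\<close> and rescaling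
  the metric by \<open>f\<close> therefore combine so that the tangential term disappears and the gradient of \<open>f\<close>
  survives as the potential force (\<open>geodesic_covector_conformal\<close>): the curvature vector \<open>k\<close> of the
  reparameterized curve satisfies \<open>m\<^sub>h(k, z) = E(z) / f\<close> (\<open>curvature_pairing\<close>). With the unit tangent
  \<open>v = x' / f\<close> the curve is thus a motion if and only if \<open>m\<^sub>h(k, z) = -\<kappa>(v, z) = \<kappa>(z, v)\<close> for all \<open>z\<close>.

  Conservation of energy says \<open>m\<^sub>h(k, v) = 0\<close>, so in dimension two only a unit normal \<open>n\<close> is left to be
  tested: \<open>k = r n\<close>, and the condition is \<open>r = \<kappa>(n, v)\<close>. Its absolute value is the statement on the
  geodesic curvature, since \<open>\<bar>\<kappa>(n, v)\<bar> = \<bar>\<kappa>/o\<^sub>h\<bar>\<close>, and its sign is the statement on the orientation,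
  since \<open>\<kappa>(k, v) = r \<kappa>(n, v)\<close> (\<open>magnetic_curvature_iff\<close>).
\<close>

section \<open>Differential calculus\<close>

abbreviation derivative_at :: "('e::euclidean_space \<Rightarrow> 'f::real_normed_vector) \<Rightarrow> 'e \<Rightarrow> 'e \<Rightarrow> 'f" ("\<D>") where
  "\<D> f q \<equiv> frechet_derivative f (at q)"

lemma times_differentiable_on_cong:
  assumes "open S" "\<And>x. x \<in> S \<Longrightarrow> f x = g x" "times_differentiable_on k f S"
  shows "times_differentiable_on k g S"
  using assms(2,3)
proof (induction k arbitrary: f g)
  case 0
  then show ?case using continuous_on_cong by force
next
  case (Suc k)
  have d: "f differentiable (at x)" if "x \<in> S" for x using Suc.prems that by auto
  have "g differentiable (at x)" if "x \<in> S" for x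
    using d[OF that] Suc.prems(1) assms(1) that
    unfolding differentiable_def by (metis has_derivative_transform_within_open)
  moreover have "times_differentiable_on k (\<lambda>x. \<D> g x v) S" for v
    using Suc.IH[of "\<lambda>x. \<D> f x v" "\<lambda>x. \<D> g x v"] Suc.prems d
      frechet_derivative_transform_within_open[OF d assms(1)] by simp
  ultimately show ?case by simp
qed

lemma times_differentiable_on_Pair:
  assumes "open S" "times_differentiable_on k f S" "times_differentiable_on k g S"
  shows "times_differentiable_on k (\<lambda>x. (f x, g x)) S"
  using assms(2,3)
proof (induction k arbitrary: f g)
  case 0
  then show ?case by (auto intro: continuous_on_Pair)
next
  case (Suc k)
  have d: "((\<lambda>x. (f x, g x)) has_derivative (\<lambda>v. (\<D> f x v, \<D> g x v))) (at x)" if "x \<in> S" for x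
    using Suc.prems that by (auto intro!: has_derivative_Pair simp flip: frechet_derivative_works)
  have "times_differentiable_on k (\<lambda>x. \<D> (\<lambda>x. (f x, g x)) x v) S" for v
  proof (rule times_differentiable_on_cong[OF assms(1)])
    show "times_differentiable_on k (\<lambda>x. (\<D> f x v, \<D> g x v)) S"
      using Suc by simp
    show "(\<D> f x v, \<D> g x v) = \<D> (\<lambda>x. (f x, g x)) x v" if "x \<in> S" for x
      using frechet_derivative_at[OF d[OF that]] by metis
  qed
  moreover have "(\<lambda>x. (f x, g x)) differentiable (at x)" if "x \<in> S" for x
    using d[OF that] by (auto simp: differentiable_def)
  ultimately show ?case by simp
qed

lemma smooth_on_differentiable:
  assumes "smooth_on S f" "x \<in> S"
  shows "f differentiable (at x)"
  using assms(1)[unfolded smooth_on_def, rule_format, of 1] assms(2) by auto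

lemma smooth_on_has_derivative:
  assumes "smooth_on S f" "x \<in> S"
  shows "(f has_derivative \<D> f x) (at x)"
  using smooth_on_differentiable[OF assms] by (simp add: frechet_derivative_works)

lemma smooth_on_derivative:
  assumes "smooth_on S f"
  shows "smooth_on S (\<lambda>x. \<D> f x v)"
  using assms unfolding smooth_on_def by (metis times_differentiable_on.simps(2))

lemma smooth_on_continuous:
  assumes "smooth_on S f"
  shows "continuous_on S f"
  using assms unfolding smooth_on_def by (metis times_differentiable_on.simps(1))

lemma smooth_on_cong:
  assumes "open S" "\<And>x. x \<in> S \<Longrightarrow> f x = g x" "smooth_on S f"
  shows "smooth_on S g"
  using assms times_differentiable_on_cong unfolding smooth_on_def by blast

lemma smooth_on_Pair:
  assumes "open S" "smooth_on S f" "smooth_on S g"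
  shows "smooth_on S (\<lambda>x. (f x, g x))"
  using assms times_differentiable_on_Pair unfolding smooth_on_def by blast

lemma has_derivative_transform_nhds:
  assumes "(f has_derivative f') (at t)" "\<forall>\<^sub>F s in nhds t. f s = g s"
  shows "(g has_derivative f') (at t)"
proof (rule has_derivative_transform_eventually[OF assms(1)])
  show "\<forall>\<^sub>F s in at t. f s = g s"
    using assms(2) by (simp add: eventually_nhds_conv_at)
  show "f t = g t" using assms(2) by (rule eventually_nhds_x_imp_x)
qed simp

lemma has_vector_derivative_transform_nhds:
  assumes "(f has_vector_derivative v) (at t)" "\<forall>\<^sub>F s in nhds t. f s = g s"
  shows "(g has_vector_derivative v) (at t)"
  using has_derivative_transform_nhds assms unfolding has_vector_derivative_def by blast

text \<open>
  Tensors are given in coordinates by their values on fixed arguments, and only these are known to be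
  differentiable. Expanding the argument in a basis turns this into the product rule for moving
  arguments.
\<close>

lemma has_derivative_linear_family:
  fixes L :: "'a::euclidean_space \<Rightarrow> 'e::euclidean_space \<Rightarrow> 'f::real_normed_vector"
  assumes lin: "\<forall>\<^sub>F q in nhds q0. linear (L q)"
    and L: "\<And>v. (\<lambda>q. L q v) differentiable (at q0)"
    and \<alpha>: "(\<alpha> has_derivative \<alpha>') (at q0)"
  shows "((\<lambda>q. L q (\<alpha> q)) has_derivative (\<lambda>w. \<D> (\<lambda>q. L q (\<alpha> q0)) q0 w + L q0 (\<alpha>' w))) (at q0)"
proof -
  obtain S where S: "open S" "q0 \<in> S" and lin': "\<And>q. q \<in> S \<Longrightarrow> linear (L q)"
    using lin unfolding eventually_nhds by blast
  have exp: "L q v = (\<Sum>b\<in>Basis. (v \<bullet> b) *\<^sub>R L q b)" if "q \<in> S" for q v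
    using linear_sum[OF lin'[OF that], of "\<lambda>b. (v \<bullet> b) *\<^sub>R b" Basis]
      linear_scale[OF lin'[OF that]] euclidean_representation[of v] by simp
  have Lb: "((\<lambda>q. L q b) has_derivative \<D> (\<lambda>q. L q b) q0) (at q0)" for b
    using L frechet_derivative_works by blast
  have 1: "((\<lambda>q. \<Sum>b\<in>Basis. (\<alpha> q \<bullet> b) *\<^sub>R L q b) has_derivative
     (\<lambda>w. \<Sum>b\<in>Basis. (\<alpha> q0 \<bullet> b) *\<^sub>R \<D> (\<lambda>q. L q b) q0 w + (\<alpha>' w \<bullet> b) *\<^sub>R L q0 b)) (at q0)"
    by (intro has_derivative_sum has_derivative_scaleR Lb has_derivative_inner_left \<alpha>)
  have 2: "((\<lambda>q. \<Sum>b\<in>Basis. (\<alpha> q0 \<bullet> b) *\<^sub>R L q b) has_derivative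
     (\<lambda>w. \<Sum>b\<in>Basis. (\<alpha> q0 \<bullet> b) *\<^sub>R \<D> (\<lambda>q. L q b) q0 w)) (at q0)"
    by (intro has_derivative_sum has_derivative_scaleR_right Lb)
  have "((\<lambda>q. L q (\<alpha> q0)) has_derivative
     (\<lambda>w. \<Sum>b\<in>Basis. (\<alpha> q0 \<bullet> b) *\<^sub>R \<D> (\<lambda>q. L q b) q0 w)) (at q0)"
    by (rule has_derivative_transform_within_open[OF 2 S]) (simp add: exp[symmetric])
  then have e: "\<D> (\<lambda>q. L q (\<alpha> q0)) q0 = (\<lambda>w. \<Sum>b\<in>Basis. (\<alpha> q0 \<bullet> b) *\<^sub>R \<D> (\<lambda>q. L q b) q0 w)"
    by (simp add: frechet_derivative_at[symmetric])
  have "((\<lambda>q. L q (\<alpha> q)) has_derivative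
     (\<lambda>w. \<Sum>b\<in>Basis. (\<alpha> q0 \<bullet> b) *\<^sub>R \<D> (\<lambda>q. L q b) q0 w + (\<alpha>' w \<bullet> b) *\<^sub>R L q0 b)) (at q0)"
    by (rule has_derivative_transform_within_open[OF 1 S]) (simp add: exp[symmetric])
  then show ?thesis
    by (simp add: e sum.distrib exp[OF S(2), of "\<alpha>' _"])
qed

text \<open>
  The right-hand side of the Koszul formula is a derivative of the metric, and has to be recognized as
  a linear functional of the argument in order to be represented by a vector.
\<close>

lemma linear_derivative_linear_family:
  fixes L :: "'a::euclidean_space \<Rightarrow> 'e::euclidean_space \<Rightarrow> 'f::real_normed_vector"
  assumes lin: "\<forall>\<^sub>F q in nhds q0. linear (L q)"
    and L: "\<And>v. (\<lambda>q. L q v) differentiable (at q0)"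
  shows "linear (\<lambda>v. \<D> (\<lambda>q. L q v) q0 w)"
proof -
  obtain S where S: "open S" "q0 \<in> S" and lin': "\<And>q. q \<in> S \<Longrightarrow> linear (L q)"
    using lin unfolding eventually_nhds by blast
  note L' = L[unfolded frechet_derivative_works]
  have D: "\<D> (\<lambda>q. L q v) q0 w = f' w" if "((\<lambda>q. L q v) has_derivative f') (at q0)" for v f'
    using that by (simp add: frechet_derivative_at[symmetric])
  show ?thesis
  proof (rule linearI)
    fix y z
    have "((\<lambda>q. L q (y + z)) has_derivative (\<lambda>w. \<D> (\<lambda>q. L q y) q0 w + \<D> (\<lambda>q. L q z) q0 w)) (at q0)"
      by (rule has_derivative_transform_within_open[OF has_derivative_add[OF L' L'] S])
         (simp add: linear_add[OF lin'])
    from D[OF this] show "\<D> (\<lambda>q. L q (y + z)) q0 w = \<D> (\<lambda>q. L q y) q0 w + \<D> (\<lambda>q. L q z) q0 w" .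
  next
    fix r z
    have "((\<lambda>q. L q (r *\<^sub>R z)) has_derivative (\<lambda>w. r *\<^sub>R \<D> (\<lambda>q. L q z) q0 w)) (at q0)"
      by (rule has_derivative_transform_within_open[OF has_derivative_scaleR_right[OF L'] S])
         (simp add: linear_scale[OF lin'])
    from D[OF this] show "\<D> (\<lambda>q. L q (r *\<^sub>R z)) q0 w = r *\<^sub>R \<D> (\<lambda>q. L q z) q0 w" .
  qed
qed

lemma has_derivative_bilinear_family:
  fixes B :: "'a::euclidean_space \<Rightarrow> 'e::euclidean_space \<Rightarrow> 'e \<Rightarrow> 'f::real_normed_vector"
  assumes bil: "\<forall>\<^sub>F q in nhds q0. bilinear (B q)"
    and B: "\<And>u v. (\<lambda>q. B q u v) differentiable (at q0)"
    and \<alpha>: "(\<alpha> has_derivative \<alpha>') (at q0)"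
    and \<beta>: "(\<beta> has_derivative \<beta>') (at q0)"
  shows "((\<lambda>q. B q (\<alpha> q) (\<beta> q)) has_derivative
    (\<lambda>w. \<D> (\<lambda>q. B q (\<alpha> q0) (\<beta> q0)) q0 w + B q0 (\<alpha>' w) (\<beta> q0) + B q0 (\<alpha> q0) (\<beta>' w))) (at q0)"
proof -
  have left: "((\<lambda>q. B q (\<alpha> q) v) has_derivative
      (\<lambda>w. \<D> (\<lambda>q. B q (\<alpha> q0) v) q0 w + B q0 (\<alpha>' w) v)) (at q0)" for v
    using bil B by (intro has_derivative_linear_family \<alpha>)
      (auto elim: eventually_mono simp: bilinear_def)
  have "((\<lambda>q. B q (\<alpha> q) (\<beta> q)) has_derivative
    (\<lambda>w. \<D> (\<lambda>q. B q (\<alpha> q) (\<beta> q0)) q0 w + B q0 (\<alpha> q0) (\<beta>' w))) (at q0)"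
    using bil left by (intro has_derivative_linear_family[of "\<lambda>q. B q (\<alpha> q)"] \<beta>)
      (auto elim: eventually_mono simp: bilinear_def differentiable_def)
  then show ?thesis
    by (simp add: frechet_derivative_at[OF left, symmetric])
qed

text \<open>
  By the mean value theorem, applied first in the direction \<open>u\<close> and then in the direction \<open>v\<close>, the
  quotient is a value of the second derivative near \<open>x\<close>. As the second difference is symmetric in
  \<open>u\<close> and \<open>v\<close>, so is the limit.
\<close>

lemma second_difference_limit:
  fixes F :: "'e::real_normed_vector \<Rightarrow> real"
  assumes S: "open S" "x \<in> S"
    and F: "\<And>q. q \<in> S \<Longrightarrow> (F has_derivative F' q) (at q)"
    and F2: "\<And>q. q \<in> S \<Longrightarrow> ((\<lambda>q. F' q u) has_derivative F2 q) (at q)"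
    and cont: "continuous_on S (\<lambda>q. F2 q v)"
  shows "((\<lambda>s. (F (x + s *\<^sub>R u + s *\<^sub>R v) - F (x + s *\<^sub>R u) - F (x + s *\<^sub>R v) + F x) / (s * s))
           \<longlongrightarrow> F2 x v) (at_right 0)"
proof (rule tendstoI)
  fix e :: real assume e: "e > 0"
  obtain d0 where d0: "d0 > 0" "ball x d0 \<subseteq> S" using S openE by blast
  have "continuous (at x) (\<lambda>q. F2 q v)" using cont S by (simp add: continuous_on_eq_continuous_at)
  then obtain d1 where d1: "d1 > 0" "\<And>q. dist q x < d1 \<Longrightarrow> dist (F2 q v) (F2 x v) < e"
    using e unfolding continuous_at_eps_delta by (metis dist_commute)
  define d where "d = min d0 d1"
  have d: "d > 0" using d0 d1 by (simp add: d_def)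
  define N where "N = norm u + norm v + 1"
  have N: "N > 0" by (simp add: N_def add_nonneg_pos)
  have near: "x + r *\<^sub>R u + r' *\<^sub>R v \<in> ball x d" if "0 \<le> r" "r \<le> s" "0 \<le> r'" "r' \<le> s" "s < d / N" "0 < s" for r r' s
  proof -
    have "norm (r *\<^sub>R u + r' *\<^sub>R v) \<le> r * norm u + r' * norm v"
      using that norm_triangle_ineq[of "r *\<^sub>R u" "r' *\<^sub>R v"] by simp
    also have "\<dots> \<le> s * norm u + s * norm v"
      using that by (intro add_mono mult_right_mono) auto
    also have "\<dots> \<le> s * N" using that by (simp add: N_def algebra_simps)
    also have "\<dots> < d" using that N by (simp add: field_simps)
    finally have "norm (r *\<^sub>R u + r' *\<^sub>R v) < d" .
    then show ?thesis by (simp add: dist_norm norm_minus_commute algebra_simps)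
  qed
  have key: "dist ((F (x + s *\<^sub>R u + s *\<^sub>R v) - F (x + s *\<^sub>R u) - F (x + s *\<^sub>R v) + F x) / (s * s)) (F2 x v) < e"
    if s: "0 < s" "s < d / N" for s
  proof -
    have inS: "x + r *\<^sub>R u + r' *\<^sub>R v \<in> S" if "0 \<le> r" "r \<le> s" "0 \<le> r'" "r' \<le> s" for r r'
      using near[OF that s(2,1)] d0 by (auto simp: d_def)
    define \<psi> where "\<psi> r = F (x + r *\<^sub>R u + s *\<^sub>R v) - F (x + r *\<^sub>R u)" for r
    have "DERIV \<psi> r :> F' (x + r *\<^sub>R u + s *\<^sub>R v) u - F' (x + r *\<^sub>R u) u" if r: "0 \<le> r" "r \<le> s" for r
    proof -
      have l: "linear (F' q)" if "q \<in> S" for q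
        using F[OF that] has_derivative_linear by blast
      have "((\<lambda>r. F (x + r *\<^sub>R u + s *\<^sub>R v)) has_derivative (\<lambda>h. F' (x + r *\<^sub>R u + s *\<^sub>R v) (h *\<^sub>R u))) (at r)"
        using r s by (intro has_derivative_compose[OF _ F]) (auto intro!: derivative_eq_intros inS)
      moreover have "((\<lambda>r. F (x + r *\<^sub>R u)) has_derivative (\<lambda>h. F' (x + r *\<^sub>R u) (h *\<^sub>R u))) (at r)"
        using r s inS[of r 0] by (intro has_derivative_compose[OF _ F]) (auto intro!: derivative_eq_intros)
      ultimately have "(\<psi> has_derivative (\<lambda>h. F' (x + r *\<^sub>R u + s *\<^sub>R v) (h *\<^sub>R u) - F' (x + r *\<^sub>R u) (h *\<^sub>R u))) (at r)"
        unfolding \<psi>_def by (rule has_derivative_diff)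
      then have "(\<psi> has_derivative (*) (F' (x + r *\<^sub>R u + s *\<^sub>R v) u - F' (x + r *\<^sub>R u) u)) (at r)"
        using l[OF inS[of r s]] l[OF inS[of r 0]] r s
        by (elim has_derivative_eq_rhs) (auto simp: fun_eq_iff linear_scale left_diff_distrib right_diff_distrib mult.commute)
      then show ?thesis by (simp add: has_field_derivative_def)
    qed
    from MVT2[OF s(1) this] obtain r where r: "0 < r" "r < s" and
      \<psi>: "\<psi> s - \<psi> 0 = s * (F' (x + r *\<^sub>R u + s *\<^sub>R v) u - F' (x + r *\<^sub>R u) u)" by auto
    have "DERIV (\<lambda>r'. F' (x + r *\<^sub>R u + r' *\<^sub>R v) u) r' :> F2 (x + r *\<^sub>R u + r' *\<^sub>R v) v"
      if r': "0 \<le> r'" "r' \<le> s" for r'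
    proof -
      have i: "x + r *\<^sub>R u + r' *\<^sub>R v \<in> S" using inS r r' by auto
      have "((\<lambda>r'. F' (x + r *\<^sub>R u + r' *\<^sub>R v) u) has_derivative (\<lambda>h. F2 (x + r *\<^sub>R u + r' *\<^sub>R v) (h *\<^sub>R v))) (at r')"
        by (rule has_derivative_compose[where f = "\<lambda>r'. x + r *\<^sub>R u + r' *\<^sub>R v" and g = "\<lambda>q. F' q u"])
           (auto intro!: derivative_eq_intros F2 i)
      then show ?thesis
        using has_derivative_linear[OF F2[OF i]]
        by (simp add: linear_scale has_field_derivative_def mult_commute_abs)
    qed
    from MVT2[OF s(1) this] obtain r' where r': "0 < r'" "r' < s" and
      "F' (x + r *\<^sub>R u + s *\<^sub>R v) u - F' (x + r *\<^sub>R u) u = s * F2 (x + r *\<^sub>R u + r' *\<^sub>R v) v" by auto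
    with \<psi> have "\<psi> s - \<psi> 0 = s * s * F2 (x + r *\<^sub>R u + r' *\<^sub>R v) v" by simp
    then have "(F (x + s *\<^sub>R u + s *\<^sub>R v) - F (x + s *\<^sub>R u) - F (x + s *\<^sub>R v) + F x) / (s * s)
        = F2 (x + r *\<^sub>R u + r' *\<^sub>R v) v"
      using s by (simp add: \<psi>_def field_simps)
    then show ?thesis
      using near[of r s r'] r r' s d1(2)[of "x + r *\<^sub>R u + r' *\<^sub>R v"] by (simp add: d_def dist_commute)
  qed
  show "\<forall>\<^sub>F s in at_right 0. dist ((F (x + s *\<^sub>R u + s *\<^sub>R v) - F (x + s *\<^sub>R u) - F (x + s *\<^sub>R v) + F x) / (s * s)) (F2 x v) < e"
    unfolding eventually_at_right_field using key d N by (metis divide_pos_pos)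
qed

lemma smooth_on_second_derivative_symmetric:
  fixes f :: "'e::euclidean_space \<Rightarrow> 'f::euclidean_space"
  assumes S: "open S" "x \<in> S" and f: "smooth_on S f"
  shows "\<D> (\<lambda>q. \<D> f q u) x v = \<D> (\<lambda>q. \<D> f q v) x u"
proof (rule euclidean_eqI)
  fix b :: 'f assume "b \<in> Basis"
  have lim: "((\<lambda>s. (f (x + s *\<^sub>R u + s *\<^sub>R v) \<bullet> b - f (x + s *\<^sub>R u) \<bullet> b - f (x + s *\<^sub>R v) \<bullet> b + f x \<bullet> b) / (s * s))
           \<longlongrightarrow> \<D> (\<lambda>q. \<D> f q u) x v \<bullet> b) (at_right 0)" for u v
    by (rule second_difference_limit[OF S, where F = "\<lambda>q. f q \<bullet> b" and F' = "\<lambda>q u. \<D> f q u \<bullet> b"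
          and ?F2.0 = "\<lambda>q v. \<D> (\<lambda>q. \<D> f q u) q v \<bullet> b"])
       (auto intro!: has_derivative_inner_left smooth_on_has_derivative smooth_on_derivative
          continuous_on_inner[OF smooth_on_continuous continuous_on_const] f)
  have "((\<lambda>s. (f (x + s *\<^sub>R u + s *\<^sub>R v) \<bullet> b - f (x + s *\<^sub>R u) \<bullet> b - f (x + s *\<^sub>R v) \<bullet> b + f x \<bullet> b) / (s * s))
           \<longlongrightarrow> \<D> (\<lambda>q. \<D> f q v) x u \<bullet> b) (at_right 0)"
    using lim[of v u] by (simp add: algebra_simps)
  then show "\<D> (\<lambda>q. \<D> f q u) x v \<bullet> b = \<D> (\<lambda>q. \<D> f q v) x u \<bullet> b"
    using lim[of u v] tendsto_unique trivial_limit_at_right_real by blast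
qed

section \<open>Atlases and tangent vectors\<close>

text \<open>
  Tangent vectors and velocities only need transition maps to be differentiable. At this level of
  generality the theory applies to a smooth atlas and to the atlas of its tangent bundle alike.
\<close>

locale differentiable_atlas =
  fixes A :: "('p, 'e::euclidean_space) chart set"
  assumes inj_chart: "c \<in> A \<Longrightarrow> inj_on (snd c) (fst c)"
    and open_overlap: "c \<in> A \<Longrightarrow> d \<in> A \<Longrightarrow> open (snd c ` (fst c \<inter> fst d))"
    and transition_differentiable:
      "c \<in> A \<Longrightarrow> d \<in> A \<Longrightarrow> q \<in> snd c ` (fst c \<inter> fst d) \<Longrightarrow> transition c d differentiable (at q)"

lemma smooth_atlas_differentiable:
  assumes "smooth_atlas A"
  shows "differentiable_atlas A"
proof
  fix c d q assume "c \<in> A" "d \<in> A" "q \<in> snd c ` (fst c \<inter> fst d)"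
  then show "transition c d differentiable at q"
    using assms smooth_on_differentiable[of "snd c ` (fst c \<inter> fst d)" "transition c d" q]
    by (simp add: smooth_atlas_def)
qed (use assms in \<open>simp_all add: smooth_atlas_def\<close>)

lemma chart_inv_in: "q \<in> snd c ` fst c \<Longrightarrow> chart_inv c q \<in> fst c"
  and snd_chart_inv: "q \<in> snd c ` fst c \<Longrightarrow> snd c (chart_inv c q) = q"
  by (auto simp: chart_inv_def intro: inv_into_into f_inv_into_f)

lemma chart_at:
  assumes "p \<in> points A"
  shows "chart_at A p \<in> A" "p \<in> fst (chart_at A p)"
proof -
  have "\<exists>c. c \<in> A \<and> p \<in> fst c" using assms by (auto simp: points_def)
  then have "chart_at A p \<in> A \<and> p \<in> fst (chart_at A p)"
    unfolding chart_at_def by (rule someI_ex)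
  then show "chart_at A p \<in> A" "p \<in> fst (chart_at A p)" by simp_all
qed

text \<open>
  The values of a chart outside its domain are arbitrary, so its composition with a curve is
  meaningful only as long as the curve stays in the domain.
\<close>

definition has_coord_velocity :: "('p, 'e::euclidean_space) chart \<Rightarrow> (real \<Rightarrow> 'p) \<Rightarrow> 'e \<Rightarrow> real \<Rightarrow> bool" where
  "has_coord_velocity c x v t \<longleftrightarrow>
     (\<forall>\<^sub>F s in nhds t. x s \<in> fst c) \<and> ((snd c \<circ> x) has_vector_derivative v) (at t)"

lemma has_coord_velocity_in: "has_coord_velocity c x v t \<Longrightarrow> x t \<in> fst c"
  by (auto simp: has_coord_velocity_def dest: eventually_nhds_x_imp_x)

context differentiable_atlas
begin

lemma open_chart_image: "c \<in> A \<Longrightarrow> open (snd c ` fst c)"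
  using open_overlap[of c c] by simp

lemma chart_inv_snd: "c \<in> A \<Longrightarrow> p \<in> fst c \<Longrightarrow> chart_inv c (snd c p) = p"
  using inj_chart by (simp add: chart_inv_def)

lemma transition_snd: "c \<in> A \<Longrightarrow> p \<in> fst c \<Longrightarrow> transition c d (snd c p) = snd d p"
  by (simp add: transition_def chart_inv_snd)

lemma transition_has_derivative:
  assumes "c \<in> A" "d \<in> A" "p \<in> fst c" "p \<in> fst d"
  shows "(transition c d has_derivative \<D> (transition c d) (snd c p)) (at (snd c p))"
  using transition_differentiable[OF assms(1,2)] assms(3,4)
  by (auto simp flip: frechet_derivative_works)

lemma transition_linear:
  assumes "c \<in> A" "d \<in> A" "p \<in> fst c" "p \<in> fst d"
  shows "linear (\<D> (transition c d) (snd c p))"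
  using transition_has_derivative[OF assms] has_derivative_linear by blast

lemma coordinate_change_has_derivative:
  assumes "c \<in> A" "d \<in> A" "p \<in> fst c" "p \<in> fst d"
    and "((f \<circ> chart_inv d) has_derivative f') (at (snd d p))"
  shows "((f \<circ> chart_inv c) has_derivative (\<lambda>u. f' (\<D> (transition c d) (snd c p) u))) (at (snd c p))"
proof -
  have "((\<lambda>q. (f \<circ> chart_inv d) (transition c d q)) has_derivative
      (\<lambda>u. f' (\<D> (transition c d) (snd c p) u))) (at (snd c p))"
    using assms(1,3,5) by (intro has_derivative_compose[OF transition_has_derivative[OF assms(1-4)]])
      (simp only: transition_snd)
  then show ?thesis
    by (rule has_derivative_transform_within_open[OF _ open_overlap[OF assms(1,2)]])
       (use assms in \<open>auto simp: transition_snd chart_inv_snd\<close>)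
qed

lemma transition_self_derivative:
  assumes "c \<in> A" "p \<in> fst c"
  shows "\<D> (transition c c) (snd c p) = id"
proof -
  have "(transition c c has_derivative id) (at (snd c p))"
    by (rule has_derivative_transform_within_open[OF has_derivative_id open_chart_image[OF assms(1)]])
       (use assms in \<open>auto simp: transition_snd\<close>)
  then show ?thesis by (rule frechet_derivative_at[symmetric])
qed

lemma transition_chain_rule:
  assumes "c \<in> A" "d \<in> A" "e \<in> A" "p \<in> fst c" "p \<in> fst d" "p \<in> fst e"
  shows "\<D> (transition c e) (snd c p) u = \<D> (transition d e) (snd d p) (\<D> (transition c d) (snd c p) u)"
proof -
  have "(transition c e has_derivative
      (\<lambda>u. \<D> (transition d e) (snd d p) (\<D> (transition c d) (snd c p) u))) (at (snd c p))"
    using coordinate_change_has_derivative[of c d p "snd e" "\<D> (transition d e) (snd d p)"] assms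
      transition_has_derivative[of d e p] by (simp add: transition_def)
  then show ?thesis by (simp add: frechet_derivative_at[symmetric])
qed

lemma coord_vector_apply:
  "d \<in> A \<Longrightarrow> p \<in> fst d \<Longrightarrow> coord_vector A c p u d = \<D> (transition c d) (snd c p) u"
  by (simp add: coord_vector_def)

lemma coord_vector_self: "c \<in> A \<Longrightarrow> p \<in> fst c \<Longrightarrow> coord_vector A c p u c = u"
  by (simp add: coord_vector_def transition_self_derivative)

lemma coord_vector_in_tangent_space:
  assumes "c \<in> A" "p \<in> fst c"
  shows "coord_vector A c p u \<in> tangent_space A p"
proof -
  have "coord_vector A c p u e = \<D> (transition d e) (snd d p) (coord_vector A c p u d)"
    if "d \<in> A" "e \<in> A" "p \<in> fst d" "p \<in> fst e" for d e
    using transition_chain_rule[of c d e p u] that assms by (simp only: coord_vector_apply)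
  moreover have "coord_vector A c p u d = 0" if "\<not> (d \<in> A \<and> p \<in> fst d)" for d
    using that by (simp only: coord_vector_def if_False)
  ultimately show ?thesis unfolding tangent_space_def by blast
qed

lemma tangent_vector_change:
  "\<xi> \<in> tangent_space A p \<Longrightarrow> c \<in> A \<Longrightarrow> d \<in> A \<Longrightarrow> p \<in> fst c \<Longrightarrow> p \<in> fst d \<Longrightarrow>
     \<xi> d = \<D> (transition c d) (snd c p) (\<xi> c)"
  unfolding tangent_space_def by blast

lemma coord_vector_of_tangent_vector:
  assumes "c \<in> A" "p \<in> fst c" "\<xi> \<in> tangent_space A p"
  shows "coord_vector A c p (\<xi> c) = \<xi>"
proof
  fix d
  have "\<not> (d \<in> A \<and> p \<in> fst d) \<Longrightarrow> \<xi> d = 0"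
    using assms(3) unfolding tangent_space_def by blast
  then show "coord_vector A c p (\<xi> c) d = \<xi> d"
    using tangent_vector_change[OF assms(3,1), of d] assms(2) unfolding coord_vector_def by presburger
qed

lemma tangent_vector_eqI:
  assumes "c \<in> A" "p \<in> fst c" "\<xi> \<in> tangent_space A p" "\<eta> \<in> tangent_space A p" "\<xi> c = \<eta> c"
  shows "\<xi> = \<eta>"
  using coord_vector_of_tangent_vector[OF assms(1,2)] assms by metis

lemma ball_tangent_space:
  assumes "c \<in> A" "p \<in> fst c"
  shows "(\<forall>\<xi>\<in>tangent_space A p. P \<xi>) \<longleftrightarrow> (\<forall>u. P (coord_vector A c p u))"
  using coord_vector_of_tangent_vector[OF assms] coord_vector_in_tangent_space[OF assms] by metis

lemma coord_vector_change:
  assumes "c \<in> A" "d \<in> A" "p \<in> fst c" "p \<in> fst d"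
  shows "coord_vector A c p u = coord_vector A d p (\<D> (transition c d) (snd c p) u)"
  using coord_vector_of_tangent_vector[OF assms(2,4) coord_vector_in_tangent_space[OF assms(1,3)]]
    coord_vector_apply assms by metis

text \<open>
  Overlaps have open coordinate images, so a curve passing through a point of the overlap stays in it
  for a short time, and the chain rule applies to the transition.
\<close>

lemma coord_velocity_change:
  assumes c: "c \<in> A" "has_coord_velocity c x v t" and d: "d \<in> A" "x t \<in> fst d"
  shows "has_coord_velocity d x (\<D> (transition c d) (snd c (x t)) v) t"
proof -
  have xc: "\<forall>\<^sub>F s in nhds t. x s \<in> fst c" and x't: "((snd c \<circ> x) has_derivative (\<lambda>h. h *\<^sub>R v)) (at t)"
    using c(2) by (auto simp: has_coord_velocity_def has_vector_derivative_def)
  have xt: "x t \<in> fst c" using has_coord_velocity_in[OF c(2)] .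
  let ?O = "snd c ` (fst c \<inter> fst d)"
  have "\<forall>\<^sub>F s in at t. (snd c \<circ> x) s \<in> ?O"
    using has_derivative_continuous[OF x't] open_overlap[OF c(1) d(1)] d xt
    unfolding isCont_def by (intro topological_tendstoD) (auto simp: o_def)
  then have "\<forall>\<^sub>F s in nhds t. (snd c \<circ> x) s \<in> ?O"
    using d xt by (auto simp: eventually_at_filter elim: eventually_mono)
  with xc have xd: "\<forall>\<^sub>F s in nhds t. x s \<in> fst d \<and> x s \<in> fst c"
    by eventually_elim (use inj_chart[OF c(1)] in \<open>auto dest: inj_onD\<close>)
  have "((\<lambda>s. transition c d ((snd c \<circ> x) s)) has_derivative
      (\<lambda>h. \<D> (transition c d) (snd c (x t)) (h *\<^sub>R v))) (at t)"
    using transition_has_derivative[OF c(1) d(1) xt d(2)]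
    by (intro has_derivative_compose[OF x't]) simp
  then have "((\<lambda>s. transition c d ((snd c \<circ> x) s)) has_derivative
      (\<lambda>h. h *\<^sub>R \<D> (transition c d) (snd c (x t)) v)) (at t)"
    by (simp only: linear_scale[OF transition_linear[OF c(1) d(1) xt d(2)]])
  moreover have "\<forall>\<^sub>F s in at t. transition c d ((snd c \<circ> x) s) = (snd d \<circ> x) s"
    using xd by (auto simp: eventually_at_filter transition_snd c elim!: eventually_mono)
  ultimately have "((snd d \<circ> x) has_derivative (\<lambda>h. h *\<^sub>R \<D> (transition c d) (snd c (x t)) v)) (at t)"
    by (rule has_derivative_transform_eventually) (use xt in \<open>simp_all add: transition_snd c\<close>)
  with xd show ?thesis
    by (auto simp: has_coord_velocity_def has_vector_derivative_def elim: eventually_mono)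
qed

lemma velocity_eq_coord_vector:
  assumes c: "c \<in> A" "has_coord_velocity c x v t"
  shows "velocity A x t = coord_vector A c (x t) v"
proof
  fix d
  show "velocity A x t d = coord_vector A c (x t) v d"
    using coord_velocity_change[OF c, of d]
    by (auto simp: velocity_def coord_vector_def has_coord_velocity_def vector_derivative_at)
qed

end

lemma differentiable_fst_comp:
  assumes "f differentiable (at (fst z))"
  shows "((\<lambda>w. f (fst w)) has_derivative (\<lambda>w. \<D> f (fst z) (fst w))) (at z)"
  using assms by (intro has_derivative_compose[OF has_derivative_fst[OF has_derivative_ident]])
    (simp add: frechet_derivative_works)

section \<open>The tangent bundle\<close>

lemma fst_tangent_chart: "fst (tangent_chart A c) = {w \<in> tangent_bundle A. fst w \<in> fst c}"
  and snd_tangent_chart: "snd (tangent_chart A c) w = (snd c (fst w), snd w c)"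
  by (simp_all add: tangent_chart_def)

context
  fixes A :: "('p, 'e::euclidean_space) chart set"
  assumes A: "smooth_atlas A"
begin

interpretation differentiable_atlas A
  by (rule smooth_atlas_differentiable[OF A])

lemma smooth_transition:
  assumes "c \<in> A" "d \<in> A"
  shows "smooth_on (snd c ` (fst c \<inter> fst d)) (transition c d)"
  using A assms by (auto simp: smooth_atlas_def)

lemma coord_vector_in_tangent_bundle:
  "c \<in> A \<Longrightarrow> p \<in> fst c \<Longrightarrow> (p, coord_vector A c p u) \<in> tangent_bundle A"
  using coord_vector_in_tangent_space by (auto simp: tangent_bundle_def points_def)

lemma inj_tangent_chart:
  assumes "c \<in> A"
  shows "inj_on (snd (tangent_chart A c)) (fst (tangent_chart A c))"
proof (rule inj_onI)
  fix w w'
  assume w: "w \<in> fst (tangent_chart A c)" and w': "w' \<in> fst (tangent_chart A c)"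
    and eq: "snd (tangent_chart A c) w = snd (tangent_chart A c) w'"
  then have "fst w = fst w'"
    using inj_chart[OF assms] by (auto simp: fst_tangent_chart snd_tangent_chart dest: inj_onD)
  moreover have "snd w = snd w'"
    using w w' eq calculation
    by (intro tangent_vector_eqI[OF assms, of "fst w"])
       (auto simp: fst_tangent_chart snd_tangent_chart tangent_bundle_def)
  ultimately show "w = w'" by (rule prod_eqI)
qed

lemma tangent_chart_inv:
  assumes "c \<in> A" "q \<in> snd c ` fst c"
  shows "chart_inv (tangent_chart A c) (q, u) = (chart_inv c q, coord_vector A c (chart_inv c q) u)"
proof -
  let ?w = "(chart_inv c q, coord_vector A c (chart_inv c q) u)"
  have "?w \<in> fst (tangent_chart A c)" "snd (tangent_chart A c) ?w = (q, u)"
    using assms by (auto simp: fst_tangent_chart snd_tangent_chart coord_vector_in_tangent_bundle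
        coord_vector_self chart_inv_in snd_chart_inv chart_inv_snd)
  then show ?thesis
    using inj_tangent_chart[OF assms(1)] unfolding chart_inv_def by (metis inv_into_f_f)
qed

lemma tangent_chart_overlap:
  assumes "c \<in> A" "d \<in> A"
  shows "snd (tangent_chart A c) ` (fst (tangent_chart A c) \<inter> fst (tangent_chart A d)) =
    snd c ` (fst c \<inter> fst d) \<times> UNIV"
proof (intro equalityI subsetI)
  fix z assume "z \<in> snd c ` (fst c \<inter> fst d) \<times> (UNIV :: 'e set)"
  then obtain p u where p: "p \<in> fst c" "p \<in> fst d" "z = (snd c p, u)" by auto
  then have "z = snd (tangent_chart A c) (p, coord_vector A c p u)"
    using assms by (simp add: snd_tangent_chart coord_vector_self)
  then show "z \<in> snd (tangent_chart A c) ` (fst (tangent_chart A c) \<inter> fst (tangent_chart A d))"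
    using p assms coord_vector_in_tangent_bundle by (auto simp: fst_tangent_chart)
qed (auto simp: fst_tangent_chart snd_tangent_chart)

lemma tangent_transition:
  assumes "c \<in> A" "d \<in> A" "q \<in> snd c ` (fst c \<inter> fst d)"
  shows "transition (tangent_chart A c) (tangent_chart A d) (q, u) =
    (transition c d q, \<D> (transition c d) q u)"
proof -
  have "q \<in> snd c ` fst c" using assms by auto
  moreover have "chart_inv c q \<in> fst d" "chart_inv c q \<in> fst c" using assms by (auto simp: chart_inv_snd)
  ultimately show ?thesis
    using assms coord_vector_apply[of d "chart_inv c q" c u]
    by (simp add: transition_def[of "tangent_chart A c"] tangent_chart_inv snd_tangent_chart snd_chart_inv)
       (simp add: transition_def)
qed

text \<open>
  The second derivative of the transition in the fibre component is the inhomogeneous term by which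
  accelerations fail to transform like vectors.
\<close>

lemma tangent_transition_has_derivative:
  assumes "c \<in> A" "d \<in> A" "q \<in> snd c ` (fst c \<inter> fst d)"
  shows "(transition (tangent_chart A c) (tangent_chart A d) has_derivative
    (\<lambda>(a, b). (\<D> (transition c d) q a, \<D> (\<lambda>q. \<D> (transition c d) q u) q a + \<D> (transition c d) q b)))
    (at (q, u))"
proof -
  let ?O = "snd c ` (fst c \<inter> fst d)" and ?\<phi> = "transition c d"
  note \<phi> = smooth_transition[OF assms(1,2)]
  have O: "open (?O \<times> (UNIV :: 'e set))" using open_overlap[OF assms(1,2)] by (simp add: open_Times)
  have d1: "?\<phi> differentiable (at q)" if "q \<in> ?O" for q using smooth_on_differentiable[OF \<phi> that] .
  have d2: "(\<lambda>q. \<D> ?\<phi> q v) differentiable (at q)" for v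
    using smooth_on_differentiable[OF smooth_on_derivative[OF \<phi>] assms(3)] .
  have d3: "((\<lambda>w. \<D> ?\<phi> (fst w) v) has_derivative (\<lambda>w. \<D> (\<lambda>q. \<D> ?\<phi> q v) q (fst w))) (at (q, u))" for v
    using differentiable_fst_comp[of "\<lambda>q. \<D> ?\<phi> q v" "(q, u)"] d2 by simp
  have "((\<lambda>w. \<D> ?\<phi> (fst w) (snd w)) has_derivative
      (\<lambda>w. \<D> (\<lambda>w. \<D> ?\<phi> (fst w) (snd (q, u))) (q, u) w + \<D> ?\<phi> (fst (q, u)) (snd w))) (at (q, u))"
  proof (rule has_derivative_linear_family)
    show "\<forall>\<^sub>F w in nhds (q, u). linear (\<D> ?\<phi> (fst w))"
      unfolding eventually_nhds using O assms(3) d1 linear_frechet_derivative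
      by (intro exI[of _ "?O \<times> UNIV"]) auto
  qed (use d3 in \<open>auto simp: differentiable_def intro!: derivative_eq_intros\<close>)
  then have "((\<lambda>w. \<D> ?\<phi> (fst w) (snd w)) has_derivative
      (\<lambda>w. \<D> (\<lambda>q. \<D> ?\<phi> q u) q (fst w) + \<D> ?\<phi> q (snd w))) (at (q, u))"
    by (simp add: frechet_derivative_at[OF d3, symmetric])
  then have "((\<lambda>w. (?\<phi> (fst w), \<D> ?\<phi> (fst w) (snd w))) has_derivative
      (\<lambda>w. (\<D> ?\<phi> q (fst w), \<D> (\<lambda>q. \<D> ?\<phi> q u) q (fst w) + \<D> ?\<phi> q (snd w)))) (at (q, u))"
    using differentiable_fst_comp[of ?\<phi> "(q, u)"] d1[OF assms(3)]
    by (intro has_derivative_Pair) simp_all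
  then have "(transition (tangent_chart A c) (tangent_chart A d) has_derivative
      (\<lambda>w. (\<D> ?\<phi> q (fst w), \<D> (\<lambda>q. \<D> ?\<phi> q u) q (fst w) + \<D> ?\<phi> q (snd w)))) (at (q, u))"
    by (rule has_derivative_transform_within_open[OF _ O])
       (use assms in \<open>auto simp: tangent_transition\<close>)
  then show ?thesis by (simp add: case_prod_unfold)
qed

lemma tangent_atlas_differentiable: "differentiable_atlas (tangent_atlas A)"
proof
  fix C D assume "C \<in> tangent_atlas A" "D \<in> tangent_atlas A"
  then obtain c d where cd: "c \<in> A" "d \<in> A" "C = tangent_chart A c" "D = tangent_chart A d"
    by (auto simp: tangent_atlas_def)
  show "open (snd C ` (fst C \<inter> fst D))"
    using open_overlap[OF cd(1,2)] by (simp add: cd tangent_chart_overlap open_Times)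
  fix z assume "z \<in> snd C ` (fst C \<inter> fst D)"
  then show "transition C D differentiable at z"
    using tangent_transition_has_derivative[OF cd(1,2)]
    by (auto simp: cd tangent_chart_overlap differentiable_def)
qed (auto simp: tangent_atlas_def inj_tangent_chart)

end

section \<open>Equations of motion in coordinates\<close>

text \<open>
  The dynamical field and the Christoffel vectors are both defined by their pairings with all vectors;
  this shows that they are well defined.
\<close>

lemma riesz_representation_bilinear:
  fixes B :: "'e::euclidean_space \<Rightarrow> 'e \<Rightarrow> real"
  assumes B: "bilinear B" and pos: "\<And>u. u \<noteq> 0 \<Longrightarrow> B u u > 0" and \<phi>: "linear \<phi>"
  shows "\<exists>!y. \<forall>z. B y z = \<phi> z"
proof -
  have l: "linear (\<lambda>y. B y z)" and r: "linear (B y)" for y z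
    using B by (auto simp: bilinear_def)
  define T where "T y = (\<Sum>b\<in>Basis. B y b *\<^sub>R b)" for y
  have T: "T y \<bullet> z = B y z" for y z
  proof -
    have "B y z = (\<Sum>b\<in>Basis. (z \<bullet> b) * B y b)"
      using linear_sum[OF r[of y], of "\<lambda>b. (z \<bullet> b) *\<^sub>R b" Basis] linear_scale[OF r[of y]]
        euclidean_representation[of z] by simp
    then show ?thesis by (simp add: T_def inner_sum_left mult.commute inner_commute[of z])
  qed
  have "linear T"
    by (rule linearI; rule euclidean_eqI)
       (simp_all add: T inner_add_left linear_add[OF l] linear_scale[OF l])
  moreover have "inj T"
  proof (rule injI)
    fix y y' assume "T y = T y'"
    then have "B (y - y') (y - y') = 0"
      using T[of y "y - y'"] T[of y' "y - y'"] linear_diff[OF l, of y y' "y - y'"] by simp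
    then show "y = y'" using pos[of "y - y'"] by force
  qed
  ultimately have "surj T" by (rule linear_injective_imp_surjective) (rule refl)
  obtain y where y: "T y = (\<Sum>b\<in>Basis. \<phi> b *\<^sub>R b)" using \<open>surj T\<close> by (metis surjD)
  have "B y z = \<phi> z" for z
  proof -
    have "\<phi> z = (\<Sum>b\<in>Basis. (z \<bullet> b) * \<phi> b)"
      using linear_sum[OF \<phi>, of "\<lambda>b. (z \<bullet> b) *\<^sub>R b" Basis] linear_scale[OF \<phi>]
        euclidean_representation[of z] by simp
    then show ?thesis using T[of y z] y by (simp add: inner_sum_left mult.commute inner_commute[of z])
  qed
  moreover have "y' = y" if "\<forall>z. B y' z = \<phi> z" for y'
  proof -
    have "T y' = T y"
      by (rule euclidean_eqI) (simp add: T that calculation)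
    then show ?thesis using \<open>inj T\<close> by (simp add: injD)
  qed
  ultimately show ?thesis by blast
qed

text \<open>
  For a curve through \<open>q\<close> with coordinate velocity \<open>u\<close> and second derivative \<open>a\<close>, this is the pairing
  of its covariant acceleration with \<open>z\<close>, written out with the Koszul formula to avoid solving for
  the Christoffel symbols.
\<close>

definition geodesic_covector ::
    "('e::euclidean_space \<Rightarrow> 'e \<Rightarrow> 'e \<Rightarrow> real) \<Rightarrow> 'e \<Rightarrow> 'e \<Rightarrow> 'e \<Rightarrow> 'e \<Rightarrow> real" where
  "geodesic_covector G q u a z = G q a z + \<D> (\<lambda>q. G q u z) q u - 1/2 * \<D> (\<lambda>q. G q u u) q z"

text \<open>
  The equation \<open>\<langle>\<nabla>\<^sub>t x', z\<rangle> = -dV(z) - \<kappa>(x', z)\<close> in the chart \<open>c\<close>.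
\<close>

definition newton_equation ::
    "('p, 'e::euclidean_space) chart set \<Rightarrow> ('p \<Rightarrow> ('p, 'e) tvec \<Rightarrow> ('p, 'e) tvec \<Rightarrow> real) \<Rightarrow>
     ('p \<Rightarrow> real) \<Rightarrow> ('p \<Rightarrow> ('p, 'e) tvec \<Rightarrow> ('p, 'e) tvec \<Rightarrow> real) \<Rightarrow>
     ('p, 'e) chart \<Rightarrow> 'e \<Rightarrow> 'e \<Rightarrow> 'e \<Rightarrow> bool" where
  "newton_equation A m V \<kappa> c q u a \<longleftrightarrow> (\<forall>z.
     geodesic_covector (coord_2tensor A m c) q u a z =
       - \<D> (V \<circ> chart_inv c) q z - coord_2tensor A \<kappa> c q u z)"

lemma (in differentiable_atlas) coord_2tensor_change:
  assumes "c \<in> A" "d \<in> A" "p \<in> fst c" "p \<in> fst d"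
  shows "coord_2tensor A \<beta> c (snd c p) u v =
    coord_2tensor A \<beta> d (snd d p) (\<D> (transition c d) (snd c p) u) (\<D> (transition c d) (snd c p) v)"
  using coord_vector_change[OF assms] assms by (simp add: coord_2tensor_def chart_inv_snd)

locale riemannian_manifold =
  fixes A :: "('p, 'e::euclidean_space) chart set"
    and m :: "'p \<Rightarrow> ('p, 'e) tvec \<Rightarrow> ('p, 'e) tvec \<Rightarrow> real"
  assumes A: "smooth_atlas A" and m: "riemannian_metric A m"
begin

sublocale differentiable_atlas A
  by (rule smooth_atlas_differentiable[OF A])

lemma metric_bilinear: "c \<in> A \<Longrightarrow> q \<in> snd c ` fst c \<Longrightarrow> bilinear (coord_2tensor A m c q)"
  using m by (auto simp: riemannian_metric_def smooth_2tensor_def)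

lemma metric_differentiable:
  assumes "c \<in> A" "q \<in> snd c ` fst c"
  shows "(\<lambda>q. coord_2tensor A m c q u v) differentiable (at q)"
proof -
  have "smooth_on (snd c ` fst c) (\<lambda>q. coord_2tensor A m c q u v)"
    using m assms(1) by (simp add: riemannian_metric_def smooth_2tensor_def)
  then show ?thesis using assms(2) by (rule smooth_on_differentiable)
qed

lemma metric_symmetric:
  assumes "c \<in> A" "q \<in> snd c ` fst c"
  shows "coord_2tensor A m c q u v = coord_2tensor A m c q v u"
proof -
  have p: "chart_inv c q \<in> fst c" "chart_inv c q \<in> points A"
    using assms chart_inv_in[of q c] by (auto simp: points_def)
  show ?thesis
    using m p coord_vector_in_tangent_space[OF assms(1) p(1)]
    by (simp add: riemannian_metric_def coord_2tensor_def)
qed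

lemma metric_positive:
  assumes "c \<in> A" "q \<in> snd c ` fst c" "u \<noteq> 0"
  shows "coord_2tensor A m c q u u > 0"
proof -
  have p: "chart_inv c q \<in> fst c" "chart_inv c q \<in> points A"
    using assms chart_inv_in[of q c] by (auto simp: points_def)
  have "coord_vector A c (chart_inv c q) u \<noteq> (\<lambda>_. 0)"
    using coord_vector_self[OF assms(1) p(1), of u] assms(3) by force
  then show ?thesis
    using m p coord_vector_in_tangent_space[OF assms(1) p(1)]
    by (simp add: riemannian_metric_def coord_2tensor_def)
qed

lemma metric_eventually_bilinear:
  assumes "c \<in> A" "q \<in> snd c ` fst c"
  shows "\<forall>\<^sub>F q in nhds q. bilinear (coord_2tensor A m c q)"
  using eventually_nhds_in_open[OF open_chart_image[OF assms(1)] assms(2)]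
  by eventually_elim (rule metric_bilinear[OF assms(1)])

text \<open>
  The product rule for \<open>m(u, v) = m(\<Phi> u, \<Phi> v)\<close>, in which the Jacobian \<open>\<Phi>\<close> depends on the point.
\<close>

lemma metric_derivative_change:
  assumes "c \<in> A" "d \<in> A" "p \<in> fst c" "p \<in> fst d"
  defines "\<Phi> \<equiv> \<D> (transition c d) (snd c p)"
    and "H \<equiv> \<lambda>u. \<D> (\<lambda>q. \<D> (transition c d) q u) (snd c p)"
    and "G \<equiv> coord_2tensor A m d"
  shows "\<D> (\<lambda>q. coord_2tensor A m c q u v) (snd c p) w =
    \<D> (\<lambda>Q. G Q (\<Phi> u) (\<Phi> v)) (snd d p) (\<Phi> w) +
    G (snd d p) (H u w) (\<Phi> v) + G (snd d p) (\<Phi> u) (H v w)"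
proof -
  let ?\<phi> = "transition c d" and ?q = "snd c p" and ?O = "snd c ` (fst c \<inter> fst d)"
  have q: "?q \<in> ?O" and Q: "snd d p \<in> snd d ` fst d" using assms by auto
  have \<phi>q: "?\<phi> ?q = snd d p" using transition_snd assms by blast
  have \<phi>: "(?\<phi> has_derivative \<Phi>) (at ?q)"
    unfolding \<Phi>_def using transition_has_derivative assms by blast
  have D\<phi>: "((\<lambda>q. \<D> ?\<phi> q u) has_derivative H u) (at ?q)" for u
    unfolding H_def using smooth_on_has_derivative[OF smooth_on_derivative[OF smooth_transition[OF A assms(1,2)]] q] .
  have G\<phi>: "((\<lambda>q. G (?\<phi> q) u v) has_derivative (\<lambda>w. \<D> (\<lambda>Q. G Q u v) (snd d p) (\<Phi> w))) (at ?q)" for u v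
    using metric_differentiable[OF assms(2) Q] \<phi>q
    by (intro has_derivative_compose[OF \<phi>]) (simp add: G_def frechet_derivative_works)
  have "\<forall>\<^sub>F q in nhds ?q. bilinear (G (?\<phi> q))"
    using eventually_nhds_in_open[OF open_overlap[OF assms(1,2)] q]
  proof eventually_elim
    case (elim q)
    then show ?case
      unfolding G_def using assms by (auto simp: transition_snd intro!: metric_bilinear)
  qed
  then have "((\<lambda>q. G (?\<phi> q) (\<D> ?\<phi> q u) (\<D> ?\<phi> q v)) has_derivative
    (\<lambda>w. \<D> (\<lambda>q. G (?\<phi> q) (\<D> ?\<phi> ?q u) (\<D> ?\<phi> ?q v)) ?q w
      + G (?\<phi> ?q) (H u w) (\<D> ?\<phi> ?q v) + G (?\<phi> ?q) (\<D> ?\<phi> ?q u) (H v w))) (at ?q)"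
    using G\<phi> by (intro has_derivative_bilinear_family D\<phi>) (auto simp: differentiable_def)
  then have "((\<lambda>q. coord_2tensor A m c q u v) has_derivative
    (\<lambda>w. \<D> (\<lambda>q. G (?\<phi> q) (\<D> ?\<phi> ?q u) (\<D> ?\<phi> ?q v)) ?q w
      + G (?\<phi> ?q) (H u w) (\<D> ?\<phi> ?q v) + G (?\<phi> ?q) (\<D> ?\<phi> ?q u) (H v w))) (at ?q)"
    by (rule has_derivative_transform_within_open[OF _ open_overlap[OF assms(1,2)] q])
       (use assms in \<open>auto simp: coord_2tensor_change[OF assms(1,2)] transition_snd\<close>)
  from frechet_derivative_at[OF this, symmetric] show ?thesis
    by (simp add: frechet_derivative_at[OF G\<phi>, symmetric] \<phi>q \<Phi>_def)
qed

text \<open>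
  The covariant acceleration is a vector. Differentiating the metric produces three terms with second
  derivatives of the transition: one is absorbed by the change of the second derivative of the curve,
  the other two cancel because second derivatives are symmetric.
\<close>

lemma geodesic_covector_change:
  assumes "c \<in> A" "d \<in> A" "p \<in> fst c" "p \<in> fst d"
  defines "\<Phi> \<equiv> \<D> (transition c d) (snd c p)"
  shows "geodesic_covector (coord_2tensor A m c) (snd c p) u a z =
    geodesic_covector (coord_2tensor A m d) (snd d p) (\<Phi> u)
      (\<D> (\<lambda>q. \<D> (transition c d) q u) (snd c p) u + \<Phi> a) (\<Phi> z)"
proof -
  let ?H = "\<lambda>u. \<D> (\<lambda>q. \<D> (transition c d) q u) (snd c p)"
  have Q: "snd d p \<in> snd d ` fst d" using assms by auto
  have "?H u z = ?H z u"
    using smooth_on_second_derivative_symmetric[OF open_overlap[OF assms(1,2)] _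
        smooth_transition[OF A assms(1,2)], of "snd c p" u z] assms by blast
  then show ?thesis
    using metric_symmetric[OF assms(2) Q, of "\<Phi> u" "?H z u"]
      bilinear_ladd[OF metric_bilinear[OF assms(2) Q], of "?H u u" "\<Phi> a" "\<Phi> z"]
    by (simp add: geodesic_covector_def metric_derivative_change[OF assms(1-4)]
        coord_2tensor_change[OF assms(1-4)] add_divide_distrib flip: \<Phi>_def)
qed

end

locale gyroscopic = riemannian_manifold A m
  for A :: "('p, 'e::euclidean_space) chart set"
    and m :: "'p \<Rightarrow> ('p, 'e) tvec \<Rightarrow> ('p, 'e) tvec \<Rightarrow> real" +
  fixes V :: "'p \<Rightarrow> real"
    and \<kappa> :: "'p \<Rightarrow> ('p, 'e) tvec \<Rightarrow> ('p, 'e) tvec \<Rightarrow> real"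
  assumes V: "smooth_function A V" and \<kappa>: "smooth_closed_2form A \<kappa>"
begin

lemma potential_has_derivative:
  assumes "c \<in> A" "q \<in> snd c ` fst c"
  shows "((V \<circ> chart_inv c) has_derivative \<D> (V \<circ> chart_inv c) q) (at q)"
proof -
  have "smooth_on (snd c ` fst c) (V \<circ> chart_inv c)"
    using V assms(1) by (simp add: smooth_function_def)
  then show ?thesis using assms(2) by (rule smooth_on_has_derivative)
qed

text \<open>
  Every \<open>z\<close> in the new chart comes from the old one, because Jacobians of transitions are invertible.
\<close>

lemma newton_equation_change:
  assumes cd: "c \<in> A" "d \<in> A" "p \<in> fst c" "p \<in> fst d"
    and N: "newton_equation A m V \<kappa> c (snd c p) u a"
  shows "newton_equation A m V \<kappa> d (snd d p) (\<D> (transition c d) (snd c p) u)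
    (\<D> (\<lambda>q. \<D> (transition c d) q u) (snd c p) u + \<D> (transition c d) (snd c p) a)"
  unfolding newton_equation_def
proof
  fix z
  define z' where "z' = \<D> (transition d c) (snd d p) z"
  have z: "\<D> (transition c d) (snd c p) z' = z"
    using transition_chain_rule[of d c d p z] transition_self_derivative[of d p] cd by (simp add: z'_def)
  have "\<D> (V \<circ> chart_inv c) (snd c p) z' = \<D> (V \<circ> chart_inv d) (snd d p) z"
    using frechet_derivative_at[OF coordinate_change_has_derivative[OF cd potential_has_derivative]] cd z
    by (metis imageI)
  then show "geodesic_covector (coord_2tensor A m d) (snd d p) (\<D> (transition c d) (snd c p) u)
     (\<D> (\<lambda>q. \<D> (transition c d) q u) (snd c p) u + \<D> (transition c d) (snd c p) a) z =
     - \<D> (V \<circ> chart_inv d) (snd d p) z - coord_2tensor A \<kappa> d (snd d p) (\<D> (transition c d) (snd c p) u) z"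
    using N[unfolded newton_equation_def, rule_format, of z']
    by (simp add: geodesic_covector_change[OF cd] coord_2tensor_change[OF cd] z)
qed

end

section \<open>The dynamical field in coordinates\<close>

context riemannian_manifold
begin

sublocale T: differentiable_atlas "tangent_atlas A"
  by (rule tangent_atlas_differentiable[OF A])

lemma tangent_chart_in: "c \<in> A \<Longrightarrow> tangent_chart A c \<in> tangent_atlas A"
  by (simp add: tangent_atlas_def)

lemma points_tangent_atlas: "points (tangent_atlas A) = tangent_bundle A"
  by (auto simp: points_def tangent_atlas_def fst_tangent_chart tangent_bundle_def)

lemma chart_at_tangent_atlas:
  assumes "w \<in> tangent_bundle A"
  obtains c where "c \<in> A" "fst w \<in> fst c" "chart_at (tangent_atlas A) w = tangent_chart A c"
proof -
  have w: "w \<in> points (tangent_atlas A)" using assms by (simp add: points_tangent_atlas)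
  from chart_at(1)[OF w] obtain c where c: "c \<in> A" "chart_at (tangent_atlas A) w = tangent_chart A c"
    unfolding tangent_atlas_def by (rule imageE)
  with chart_at(2)[OF w] show thesis by (intro that[of c]) (simp_all add: fst_tangent_chart)
qed

lemma double_tangent_vector_change:
  assumes w: "w \<in> tangent_bundle A" and Y: "Y \<in> tangent_space (tangent_atlas A) w"
    and cd: "c \<in> A" "d \<in> A" "fst w \<in> fst c" "fst w \<in> fst d"
  shows "Y (tangent_chart A d) = (\<D> (transition c d) (snd c (fst w)) (fst (Y (tangent_chart A c))),
     \<D> (\<lambda>q. \<D> (transition c d) q (snd w c)) (snd c (fst w)) (fst (Y (tangent_chart A c))) +
     \<D> (transition c d) (snd c (fst w)) (snd (Y (tangent_chart A c))))"
proof -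
  have "Y (tangent_chart A d) = \<D> (transition (tangent_chart A c) (tangent_chart A d))
      (snd (tangent_chart A c) w) (Y (tangent_chart A c))"
    using T.tangent_vector_change[OF Y] w cd by (simp add: tangent_chart_in fst_tangent_chart)
  then show ?thesis
    using frechet_derivative_at[OF tangent_transition_has_derivative[OF A cd(1,2)], symmetric] cd
    by (simp add: snd_tangent_chart case_prod_unfold)
qed

lemma differential_fst:
  assumes w: "w \<in> tangent_bundle A" and Y: "Y \<in> tangent_space (tangent_atlas A) w"
    and c: "c \<in> A" "fst w \<in> fst c"
  shows "differential (tangent_atlas A) A fst w Y = coord_vector A c (fst w) (fst (Y (tangent_chart A c)))"
proof
  fix d
  obtain e where e: "e \<in> A" "fst w \<in> fst e" "chart_at (tangent_atlas A) w = tangent_chart A e"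
    using chart_at_tangent_atlas[OF w] .
  show "differential (tangent_atlas A) A fst w Y d = coord_vector A c (fst w) (fst (Y (tangent_chart A c))) d"
  proof (cases "d \<in> A \<and> fst w \<in> fst d")
    case True
    have "((\<lambda>z. transition e d (fst z)) has_derivative
        (\<lambda>z. \<D> (transition e d) (snd e (fst w)) (fst z))) (at (snd (tangent_chart A e) w))"
      using differentiable_fst_comp[of "transition e d" "snd (tangent_chart A e) w"]
        transition_differentiable[of e d] e True by (auto simp: snd_tangent_chart)
    moreover have "open (snd e ` fst e \<times> (UNIV :: 'e set))"
      using open_chart_image[OF e(1)] by (simp add: open_Times)
    ultimately have "((snd d \<circ> fst \<circ> chart_inv (tangent_chart A e)) has_derivative
        (\<lambda>z. \<D> (transition e d) (snd e (fst w)) (fst z))) (at (snd (tangent_chart A e) w))"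
      by (rule has_derivative_transform_within_open)
         (use e in \<open>auto simp: snd_tangent_chart tangent_chart_inv[OF A] chart_inv_snd transition_snd\<close>)
    from frechet_derivative_at[OF this, symmetric] show ?thesis
      using True double_tangent_vector_change[OF w Y c(1) e(1) c(2) e(2)] c e
      by (simp add: differential_def Let_def coord_vector_apply transition_chain_rule[of c e d])
  qed (auto simp: differential_def coord_vector_def)
qed

text \<open>
  In coordinates \<open>\<theta> = \<Sum>\<^sub>i\<^sub>j g\<^sub>i\<^sub>j u\<^sup>i dq\<^sup>j\<close>: it pairs the momentum with the base component.
\<close>

lemma coord_lagrange_1form:
  assumes "c \<in> A" "q \<in> snd c ` fst c"
  shows "coord_1form (tangent_atlas A) (lagrange_1form A m) (tangent_chart A c) (q, u) ab =
    coord_2tensor A m c q u (fst ab)"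
proof -
  let ?w = "(chart_inv c q, coord_vector A c (chart_inv c q) u)"
  have p: "chart_inv c q \<in> fst c" using assms chart_inv_in by metis
  have w: "?w \<in> tangent_bundle A" using coord_vector_in_tangent_bundle[OF A assms(1) p] .
  have W: "?w \<in> fst (tangent_chart A c)" using w p by (simp add: fst_tangent_chart)
  note C = tangent_chart_in[OF assms(1)]
  show ?thesis
    using differential_fst[OF w T.coord_vector_in_tangent_space[OF C W] assms(1)] p
      T.coord_vector_self[OF C W]
    by (simp add: coord_1form_def lagrange_1form_def coord_2tensor_def tangent_chart_inv[OF A assms])
qed

lemma momentum_has_derivative:
  assumes "c \<in> A" "q \<in> snd c ` fst c"
  shows "((\<lambda>z. coord_2tensor A m c (fst z) (snd z) v) has_derivative
    (\<lambda>z. \<D> (\<lambda>q. coord_2tensor A m c q u v) q (fst z) + coord_2tensor A m c q (snd z) v)) (at (q, u))"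
proof -
  let ?G = "coord_2tensor A m c"
  have G: "((\<lambda>z. ?G (fst z) u v) has_derivative (\<lambda>z. \<D> (\<lambda>q. ?G q u v) q (fst z))) (at (q, u'))" for u u' :: 'e
    using differentiable_fst_comp[of "\<lambda>q. ?G q u v" "(q, u')"] metric_differentiable[OF assms] by simp
  have "((\<lambda>z. ?G (fst z) (snd z) v) has_derivative
      (\<lambda>z. \<D> (\<lambda>z. ?G (fst z) (snd (q, u)) v) (q, u) z + ?G (fst (q, u)) (snd z) v)) (at (q, u))"
  proof (rule has_derivative_linear_family)
    have "\<forall>\<^sub>F z in nhds (q, u). z \<in> snd c ` fst c \<times> UNIV"
      using open_chart_image[OF assms(1)] assms(2) by (intro eventually_nhds_in_open) (auto simp: open_Times)
    then show "\<forall>\<^sub>F z in nhds (q, u). linear (\<lambda>u. ?G (fst z) u v)"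
      by eventually_elim (use metric_bilinear[OF assms(1)] in \<open>auto simp: bilinear_def\<close>)
  qed (use G in \<open>auto simp: differentiable_def intro!: derivative_eq_intros\<close>)
  then show ?thesis by (simp add: frechet_derivative_at[OF G, symmetric])
qed

lemma lagrange_2form_coords:
  assumes w: "w \<in> tangent_bundle A" and Y: "Y \<in> tangent_space (tangent_atlas A) w"
    and Z: "Z \<in> tangent_space (tangent_atlas A) w"
    and c: "c \<in> A" "fst w \<in> fst c" "chart_at (tangent_atlas A) w = tangent_chart A c"
  defines "G \<equiv> coord_2tensor A m c" and "q \<equiv> snd c (fst w)" and "u \<equiv> snd w c"
    and "y \<equiv> Y (tangent_chart A c)" and "z \<equiv> Z (tangent_chart A c)"
  shows "lagrange_2form A m w Y Z =
    \<D> (\<lambda>q. G q u (fst z)) q (fst y) + G q (snd y) (fst z) -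
    (\<D> (\<lambda>q. G q u (fst y)) q (fst z) + G q (snd z) (fst y))"
proof -
  have q: "q \<in> snd c ` fst c" using c by (simp add: q_def)
  have O: "open (snd c ` fst c \<times> (UNIV :: 'e set))"
    using open_chart_image[OF c(1)] by (simp add: open_Times)
  have "((\<lambda>x. coord_1form (tangent_atlas A) (lagrange_1form A m) (tangent_chart A c) x v) has_derivative
    (\<lambda>x. \<D> (\<lambda>q. G q u (fst v)) q (fst x) + G q (snd x) (fst v))) (at (q, u))" for v
    unfolding G_def
    by (rule has_derivative_transform_within_open[OF momentum_has_derivative[OF c(1) q] O])
       (use q c in \<open>auto simp: coord_lagrange_1form\<close>)
  from frechet_derivative_at[OF this, symmetric] show ?thesis
    by (simp add: lagrange_2form_def ext_deriv_def Let_def c(3) snd_tangent_chart y_def z_def flip: q_def u_def)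
qed

end

context gyroscopic
begin

lemma energy_differential_coords:
  fixes Z :: "('p \<times> ('p, 'e) tvec, 'e \<times> 'e) tvec"
  assumes w: "w \<in> tangent_bundle A"
    and c: "c \<in> A" "fst w \<in> fst c" "chart_at (tangent_atlas A) w = tangent_chart A c"
  defines "G \<equiv> coord_2tensor A m c" and "q \<equiv> snd c (fst w)" and "u \<equiv> snd w c"
    and "z \<equiv> Z (tangent_chart A c)"
  shows "function_differential (tangent_atlas A) (\<lambda>w. kinetic_energy m w + V (fst w)) w Z =
    1/2 * \<D> (\<lambda>q. G q u u) q (fst z) + G q u (snd z) + \<D> (V \<circ> chart_inv c) q (fst z)"
proof -
  have q: "q \<in> snd c ` fst c" using c by (simp add: q_def)
  have O: "open (snd c ` fst c \<times> (UNIV :: 'e set))"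
    using open_chart_image[OF c(1)] by (simp add: open_Times)
  have G: "((\<lambda>z. G (fst z) u v) has_derivative (\<lambda>z. \<D> (\<lambda>q. G q u v) q (fst z))) (at (q, u'))" for u v u' :: 'e
    using differentiable_fst_comp[of "\<lambda>q. G q u v" "(q, u')"] metric_differentiable[OF c(1) q]
    by (simp add: G_def)
  have "((\<lambda>z. G (fst z) (snd z) (snd z)) has_derivative
      (\<lambda>z. \<D> (\<lambda>z. G (fst z) (snd (q, u)) (snd (q, u))) (q, u) z + G (fst (q, u)) (snd z) (snd (q, u))
        + G (fst (q, u)) (snd (q, u)) (snd z))) (at (q, u))"
  proof (rule has_derivative_bilinear_family)
    have "\<forall>\<^sub>F z in nhds (q, u). z \<in> snd c ` fst c \<times> UNIV"
      using O q by (intro eventually_nhds_in_open) auto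
    then show "\<forall>\<^sub>F z in nhds (q, u). bilinear (G (fst z))"
      by eventually_elim (use metric_bilinear[OF c(1)] in \<open>auto simp: G_def\<close>)
  qed (use G in \<open>auto simp: differentiable_def intro!: derivative_eq_intros\<close>)
  then have "((\<lambda>z. G (fst z) (snd z) (snd z)) has_derivative
      (\<lambda>z. \<D> (\<lambda>q. G q u u) q (fst z) + 2 * G q u (snd z))) (at (q, u))"
    by (rule has_derivative_eq_rhs)
       (use metric_symmetric[OF c(1) q, of _ u, folded G_def] in
         \<open>simp add: fun_eq_iff frechet_derivative_at[OF G, symmetric]\<close>)
  moreover have "((\<lambda>z. (V \<circ> chart_inv c) (fst z)) has_derivative
      (\<lambda>z. \<D> (V \<circ> chart_inv c) q (fst z))) (at (q, u))"
    using differentiable_fst_comp[of "V \<circ> chart_inv c" "(q, u)"] potential_has_derivative[OF c(1) q]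
    by (simp add: frechet_derivative_works)
  ultimately have "((\<lambda>z. 1/2 * G (fst z) (snd z) (snd z) + (V \<circ> chart_inv c) (fst z)) has_derivative
      (\<lambda>z. 1/2 * (\<D> (\<lambda>q. G q u u) q (fst z) + 2 * G q u (snd z)) + \<D> (V \<circ> chart_inv c) q (fst z))) (at (q, u))"
    by (intro has_derivative_add has_derivative_mult_right)
  then have "((\<lambda>w. kinetic_energy m w + V (fst w)) \<circ> chart_inv (tangent_chart A c) has_derivative
      (\<lambda>z. 1/2 * (\<D> (\<lambda>q. G q u u) q (fst z) + 2 * G q u (snd z)) + \<D> (V \<circ> chart_inv c) q (fst z))) (at (q, u))"
    by (rule has_derivative_transform_within_open[OF _ O])
       (use q c in \<open>auto simp: tangent_chart_inv[OF A] kinetic_energy_def G_def coord_2tensor_def\<close>)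
  from frechet_derivative_at[OF this, symmetric] show ?thesis
    by (simp add: function_differential_def Let_def c(3) snd_tangent_chart z_def algebra_simps flip: q_def u_def)
qed

text \<open>
  Vertical test vectors (first component zero) force the base component of \<open>Y\<close> to be the velocity
  \<open>u\<close>, because the metric is nondegenerate. Once this is known the vertical terms on both sides agree,
  and vectors with second component zero give Newton's equation.
\<close>

lemma dynamical_equation_iff_newton:
  assumes w: "w \<in> tangent_bundle A" and Y: "Y \<in> tangent_space (tangent_atlas A) w"
    and c: "c \<in> A" "fst w \<in> fst c" "chart_at (tangent_atlas A) w = tangent_chart A c"
  shows "(\<forall>Z\<in>tangent_space (tangent_atlas A) w.
        lagrange_2form A m w Y Z + pullback_2form (tangent_atlas A) A fst \<kappa> w Y Z =
        - function_differential (tangent_atlas A) (\<lambda>w. kinetic_energy m w + V (fst w)) w Z) \<longleftrightarrow>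
    fst (Y (tangent_chart A c)) = snd w c \<and>
    newton_equation A m V \<kappa> c (snd c (fst w)) (snd w c) (snd (Y (tangent_chart A c)))"
    (is "?L \<longleftrightarrow> ?R")
proof -
  let ?C = "tangent_chart A c" and ?q = "snd c (fst w)" and ?u = "snd w c"
  let ?G = "coord_2tensor A m c" and ?K = "coord_2tensor A \<kappa> c"
  define y1 y2 where "y1 = fst (Y ?C)" and "y2 = snd (Y ?C)"
  have q: "?q \<in> snd c ` fst c" using c by simp
  have C: "?C \<in> tangent_atlas A" "w \<in> fst ?C"
    using c w by (simp_all add: tangent_chart_in fst_tangent_chart)
  define E where "E z1 z2 \<longleftrightarrow>
    \<D> (\<lambda>q. ?G q ?u z1) ?q y1 + ?G ?q y2 z1 - (\<D> (\<lambda>q. ?G q ?u y1) ?q z1 + ?G ?q z2 y1) + ?K ?q y1 z1 =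
    - (1/2 * \<D> (\<lambda>q. ?G q ?u ?u) ?q z1 + ?G ?q ?u z2 + \<D> (V \<circ> chart_inv c) ?q z1)" for z1 z2
  have "?L \<longleftrightarrow> (\<forall>Z\<in>tangent_space (tangent_atlas A) w. E (fst (Z ?C)) (snd (Z ?C)))"
  proof (rule ball_cong[OF refl])
    fix Z assume Z: "Z \<in> tangent_space (tangent_atlas A) w"
    show "(lagrange_2form A m w Y Z + pullback_2form (tangent_atlas A) A fst \<kappa> w Y Z =
        - function_differential (tangent_atlas A) (\<lambda>w. kinetic_energy m w + V (fst w)) w Z) \<longleftrightarrow>
        E (fst (Z ?C)) (snd (Z ?C))"
      unfolding lagrange_2form_coords[OF w Y Z c] energy_differential_coords[OF w c]
        pullback_2form_def differential_fst[OF w Y c(1,2)] differential_fst[OF w Z c(1,2)] E_def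
      using c by (simp add: coord_2tensor_def chart_inv_snd y1_def y2_def)
  qed
  also have "\<dots> \<longleftrightarrow> (\<forall>z1 z2. E z1 z2)"
    by (simp add: T.ball_tangent_space[OF C] T.coord_vector_self[OF C])
  also have "\<dots> \<longleftrightarrow> y1 = ?u \<and> newton_equation A m V \<kappa> c ?q ?u y2"
  proof
    note B = metric_bilinear[OF c(1) q]
    assume E: "\<forall>z1 z2. E z1 z2"
    have "?G ?q z y1 = ?G ?q ?u z" for z
      using E[rule_format, of 0 z] E[rule_format, of 0 0] by (simp add: E_def bilinear_lzero[OF B] bilinear_rzero[OF B])
    then have "?G ?q (y1 - ?u) (y1 - ?u) = 0"
      using metric_symmetric[OF c(1) q, of ?u "y1 - ?u"] by (simp add: bilinear_rsub[OF B])
    then have y1: "y1 = ?u"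
      using metric_positive[OF c(1) q, of "y1 - ?u"] by force
    have "newton_equation A m V \<kappa> c ?q ?u y2"
      unfolding newton_equation_def geodesic_covector_def
    proof
      fix z
      show "?G ?q y2 z + \<D> (\<lambda>q. ?G q ?u z) ?q ?u - 1/2 * \<D> (\<lambda>q. ?G q ?u ?u) ?q z =
          - \<D> (V \<circ> chart_inv c) ?q z - ?K ?q ?u z"
        using E[rule_format, of z 0] by (simp add: E_def y1 bilinear_lzero[OF B] bilinear_rzero[OF B])
    qed
    with y1 show "y1 = ?u \<and> newton_equation A m V \<kappa> c ?q ?u y2" by blast
  next
    assume N: "y1 = ?u \<and> newton_equation A m V \<kappa> c ?q ?u y2"
    show "\<forall>z1 z2. E z1 z2"
    proof (intro allI)
      fix z1 z2
      show "E z1 z2"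
        using N[THEN conjunct2, unfolded newton_equation_def geodesic_covector_def, rule_format, of z1]
          metric_symmetric[OF c(1) q, of z2 ?u] N by (simp add: E_def)
    qed
  qed
  finally show ?thesis by (simp add: y1_def y2_def)
qed

lemma newton_equation_unique_solution:
  assumes "c \<in> A" "q \<in> snd c ` fst c"
  shows "\<exists>!a. newton_equation A m V \<kappa> c q u a"
proof -
  let ?G = "coord_2tensor A m c" and ?K = "coord_2tensor A \<kappa> c"
  have l: "linear (\<lambda>z. \<D> (\<lambda>q. ?G q u z) q v)" for v
    by (rule linear_derivative_linear_family[OF eventually_mono[OF metric_eventually_bilinear[OF assms]]
          metric_differentiable[OF assms]]) (simp add: bilinear_def)
  have "linear (\<lambda>z. - \<D> (V \<circ> chart_inv c) q z - ?K q u z - \<D> (\<lambda>q. ?G q u z) q u + 1/2 * \<D> (\<lambda>q. ?G q u u) q z)"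
  proof -
    have "linear (\<D> (V \<circ> chart_inv c) q)" "linear (\<D> (\<lambda>q. ?G q u u) q)"
      using potential_has_derivative[OF assms] metric_differentiable[OF assms] has_derivative_linear
        linear_frechet_derivative by blast+
    moreover have "linear (?K q u)"
      using \<kappa> assms by (auto simp: smooth_closed_2form_def smooth_2tensor_def bilinear_def)
    ultimately show ?thesis
      using l[of u] by (intro linear_compose_add linear_compose_sub linear_compose_neg linear_compose_scale_right[where 'b=real, simplified])
  qed
  from riesz_representation_bilinear[OF metric_bilinear[OF assms] metric_positive[OF assms] this]
  have "\<exists>!a. \<forall>z. ?G q a z = - \<D> (V \<circ> chart_inv c) q z - ?K q u z - \<D> (\<lambda>q. ?G q u z) q u + 1/2 * \<D> (\<lambda>q. ?G q u u) q z"
    by simp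
  moreover have "newton_equation A m V \<kappa> c q u a \<longleftrightarrow>
    (\<forall>z. ?G q a z = - \<D> (V \<circ> chart_inv c) q z - ?K q u z - \<D> (\<lambda>q. ?G q u z) q u + 1/2 * \<D> (\<lambda>q. ?G q u u) q z)" for a
    unfolding newton_equation_def geodesic_covector_def by (intro arg_cong[of _ _ All] ext) argo
  ultimately show ?thesis by simp
qed

text \<open>
  The equation defining the field is evaluated in a chart which is not under control. Covariance of
  Newton's equation makes the description valid in every chart.
\<close>

theorem dynamical_field_iff_newton:
  assumes w: "w \<in> tangent_bundle A" and Y: "Y \<in> tangent_space (tangent_atlas A) w"
    and d: "d \<in> A" "fst w \<in> fst d"
  shows "Y = dynamical_field A m V \<kappa> w \<longleftrightarrow>
    fst (Y (tangent_chart A d)) = snd w d \<and>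
    newton_equation A m V \<kappa> d (snd d (fst w)) (snd w d) (snd (Y (tangent_chart A d)))"
proof -
  obtain c where c: "c \<in> A" "fst w \<in> fst c" "chart_at (tangent_atlas A) w = tangent_chart A c"
    using chart_at_tangent_atlas[OF w] .
  let ?C = "tangent_chart A c" and ?q = "snd c (fst w)"
  have C: "?C \<in> tangent_atlas A" "w \<in> fst ?C"
    using c w by (simp_all add: tangent_chart_in fst_tangent_chart)
  have \<xi>: "snd w \<in> tangent_space A (fst w)" using w by (auto simp: tangent_bundle_def)
  let ?P = "\<lambda>d Y. fst (Y (tangent_chart A d)) = snd w d \<and>
    newton_equation A m V \<kappa> d (snd d (fst w)) (snd w d) (snd (Y (tangent_chart A d)))"
  let ?Q = "\<lambda>Y. Y \<in> tangent_space (tangent_atlas A) w \<and> (\<forall>Z\<in>tangent_space (tangent_atlas A) w.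
        lagrange_2form A m w Y Z + pullback_2form (tangent_atlas A) A fst \<kappa> w Y Z =
        - function_differential (tangent_atlas A) (\<lambda>w. kinetic_energy m w + V (fst w)) w Z)"
  have Q: "?Q Y \<longleftrightarrow> Y \<in> tangent_space (tangent_atlas A) w \<and> ?P c Y" for Y
    using dynamical_equation_iff_newton[OF w _ c] by blast
  obtain a where a: "newton_equation A m V \<kappa> c ?q (snd w c) a"
    and a': "\<And>b. newton_equation A m V \<kappa> c ?q (snd w c) b \<Longrightarrow> b = a"
    using newton_equation_unique_solution[of c ?q "snd w c"] c by blast
  define X where "X = coord_vector (tangent_atlas A) ?C w (snd w c, a)"
  have X: "X ?C = (snd w c, a)" "X \<in> tangent_space (tangent_atlas A) w"
    unfolding X_def using T.coord_vector_self[OF C] T.coord_vector_in_tangent_space[OF C] by auto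
  have uniq: "?Q Y \<longleftrightarrow> Y = X" for Y
  proof
    assume "?Q Y"
    then have Y: "Y \<in> tangent_space (tangent_atlas A) w" "?P c Y" using Q by blast+
    then have "snd (Y ?C) = a" using a' by blast
    then have "Y ?C = X ?C" using Y X(1) by (simp add: prod_eq_iff)
    then show "Y = X" by (rule T.tangent_vector_eqI[OF C Y(1) X(2)])
  next
    assume "Y = X"
    moreover have "?P c X" using a X(1) by simp
    ultimately show "?Q Y" using Q X(2) by blast
  qed
  have "dynamical_field A m V \<kappa> w = X"
    unfolding dynamical_field_def using uniq by (intro the_equality) blast+
  then have "Y = dynamical_field A m V \<kappa> w \<longleftrightarrow> ?P c Y"
    using uniq[of Y] Q[of Y] Y by blast
  moreover have change: "?P d Y" if P: "?P c Y" and c: "c \<in> A" "fst w \<in> fst c" and d: "d \<in> A" "fst w \<in> fst d" for c d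
    using newton_equation_change[OF c(1) d(1) c(2) d(2) P[THEN conjunct2]] P[THEN conjunct1]
    by (simp add: double_tangent_vector_change[OF w Y c(1) d(1) c(2) d(2)]
        tangent_vector_change[OF \<xi> c(1) d(1) c(2) d(2)])
  ultimately show ?thesis using c d by blast
qed

end

section \<open>Curves and their lifts to the tangent bundle\<close>

lemma has_coord_velocity_transform:
  assumes "has_coord_velocity c x v t" "\<forall>\<^sub>F s in nhds t. x s = y s"
  shows "has_coord_velocity c y v t"
proof -
  have "((snd c \<circ> y) has_vector_derivative v) (at t)"
    by (rule has_vector_derivative_transform_nhds[of "snd c \<circ> x"])
       (use assms in \<open>auto simp: has_coord_velocity_def elim: eventually_mono\<close>)
  moreover have "\<forall>\<^sub>F s in nhds t. y s \<in> fst c"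
    using assms(2) assms(1)[unfolded has_coord_velocity_def, THEN conjunct1] by eventually_elim simp
  ultimately show ?thesis by (simp add: has_coord_velocity_def)
qed

context differentiable_atlas
begin

lemma smooth_curve_coord_velocity:
  assumes x: "smooth_curve A J x" "t \<in> J" and c: "c \<in> A" "x t \<in> fst c"
  shows "has_coord_velocity c x (velocity A x t c) t"
proof -
  obtain d e where d: "d \<in> A" "e > 0" "x ` ball t e \<subseteq> fst d" "smooth_on (ball t e) (snd d \<circ> x)"
    using x by (auto simp: smooth_curve_def)
  have "((snd d \<circ> x) has_vector_derivative vector_derivative (snd d \<circ> x) (at t)) (at t)"
    using smooth_on_differentiable[OF d(4), of t] d(2) by (simp add: vector_derivative_works)
  moreover have "\<forall>\<^sub>F s in nhds t. x s \<in> fst d"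
    using eventually_nhds_ball[OF d(2), of t] by eventually_elim (use d(3) in blast)
  ultimately have "has_coord_velocity d x (vector_derivative (snd d \<circ> x) (at t)) t"
    by (simp add: has_coord_velocity_def)
  from coord_velocity_change[OF d(1) this c] have *: "has_coord_velocity c x
      (\<D> (transition d c) (snd d (x t)) (vector_derivative (snd d \<circ> x) (at t))) t" .
  show ?thesis
    using * velocity_eq_coord_vector[OF c(1) *] coord_vector_self[OF c] by simp
qed

lemma smooth_curve_in_chart:
  assumes "smooth_curve A J x" "t \<in> J"
  obtains c where "c \<in> A" "x t \<in> fst c"
  using assms centre_in_ball unfolding smooth_curve_def by (metis image_subset_iff)

lemma velocity_in_tangent_space:
  assumes x: "smooth_curve A J x" "t \<in> J"
  shows "velocity A x t \<in> tangent_space A (x t)"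
proof -
  obtain c where c: "c \<in> A" "x t \<in> fst c" using smooth_curve_in_chart[OF x] .
  show ?thesis
    by (subst velocity_eq_coord_vector[OF c(1) smooth_curve_coord_velocity[OF x c]])
       (rule coord_vector_in_tangent_space[OF c])
qed

end

definition lift :: "('p, 'e::euclidean_space) chart set \<Rightarrow> (real \<Rightarrow> 'p) \<Rightarrow> real \<Rightarrow> 'p \<times> ('p, 'e) tvec" where
  "lift A x t = (x t, velocity A x t)"

context riemannian_manifold
begin

lemma lift_in_tangent_bundle:
  assumes "smooth_curve A J x" "t \<in> J"
  shows "lift A x t \<in> tangent_bundle A"
  using velocity_in_tangent_space[OF assms] smooth_curve_in_chart[OF assms]
  by (metis UN_I lift_def mem_Sigma_iff points_def tangent_bundle_def)

text \<open>
  In a chart the lift is \<open>(q, q')\<close>, and derivatives of smooth maps are smooth.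
\<close>

lemma smooth_curve_lift:
  assumes x: "smooth_curve A J x"
  shows "smooth_curve (tangent_atlas A) J (lift A x)"
  unfolding smooth_curve_def
proof
  fix t assume "t \<in> J"
  then obtain c e where c: "c \<in> A" "e > 0" "ball t e \<subseteq> J" "x ` ball t e \<subseteq> fst c"
      "smooth_on (ball t e) (snd c \<circ> x)"
    using x by (auto simp: smooth_curve_def)
  let ?C = "tangent_chart A c"
  have "lift A x ` ball t e \<subseteq> fst ?C"
    using c(3,4) lift_in_tangent_bundle[OF x] by (auto simp: fst_tangent_chart) (auto simp: lift_def)
  moreover have "smooth_on (ball t e) (snd ?C \<circ> lift A x)"
  proof (rule smooth_on_cong)
    show "smooth_on (ball t e) (\<lambda>s. ((snd c \<circ> x) s, \<D> (snd c \<circ> x) s 1))"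
      by (intro smooth_on_Pair smooth_on_derivative c(5)) simp
    fix s assume s: "s \<in> ball t e"
    have "\<D> (snd c \<circ> x) s 1 = vector_derivative (snd c \<circ> x) (at s)"
      using frechet_derivative_eq_vector_derivative[OF smooth_on_differentiable[OF c(5) s]] by simp
    then show "((snd c \<circ> x) s, \<D> (snd c \<circ> x) s 1) = (snd ?C \<circ> lift A x) s"
      using c(1,4) s by (auto simp: snd_tangent_chart lift_def velocity_def image_subset_iff)
  qed simp
  ultimately show "\<exists>C\<in>tangent_atlas A. \<exists>e>0. ball t e \<subseteq> J \<and> lift A x ` ball t e \<subseteq> fst C \<and>
      smooth_on (ball t e) (snd C \<circ> lift A x)"
    using c tangent_chart_in by blast
qed

lemma lift_velocity:
  assumes x: "smooth_curve A J x" "t \<in> J" and c: "c \<in> A" "x t \<in> fst c"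
  shows "((\<lambda>s. velocity A x s c) has_vector_derivative
      vector_derivative (\<lambda>s. velocity A x s c) (at t)) (at t)"
    and "velocity (tangent_atlas A) (lift A x) t (tangent_chart A c) =
      (velocity A x t c, vector_derivative (\<lambda>s. velocity A x s c) (at t))"
proof -
  let ?C = "tangent_chart A c" and ?W = "velocity (tangent_atlas A) (lift A x) t (tangent_chart A c)"
  have "lift A x t \<in> fst ?C"
    using c lift_in_tangent_bundle[OF x] by (simp add: fst_tangent_chart) (simp add: lift_def)
  from T.smooth_curve_coord_velocity[OF smooth_curve_lift[OF x(1)] x(2) tangent_chart_in[OF c(1)] this]
  have W: "((\<lambda>s. (snd c (x s), velocity A x s c)) has_vector_derivative ?W) (at t)"
    unfolding has_coord_velocity_def by (simp only: o_def snd_tangent_chart lift_def fst_conv snd_conv)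
  from bounded_linear.has_vector_derivative[OF bounded_linear_snd W]
  have 2: "((\<lambda>s. velocity A x s c) has_vector_derivative snd ?W) (at t)" by simp
  from bounded_linear.has_vector_derivative[OF bounded_linear_fst W]
  have 1: "((snd c \<circ> x) has_vector_derivative fst ?W) (at t)" by (simp add: o_def)
  have "((snd c \<circ> x) has_vector_derivative velocity A x t c) (at t)"
    using smooth_curve_coord_velocity[OF x c] by (simp add: has_coord_velocity_def)
  with 1 have "fst ?W = velocity A x t c" by (rule vector_derivative_unique_at)
  with vector_derivative_at[OF 2]
  show "?W = (velocity A x t c, vector_derivative (\<lambda>s. velocity A x s c) (at t))"
    by (simp add: prod_eq_iff)
  show "((\<lambda>s. velocity A x s c) has_vector_derivative
      vector_derivative (\<lambda>s. velocity A x s c) (at t)) (at t)"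
    using 2 vector_derivative_at[OF 2] by simp
qed

end

context gyroscopic
begin

text \<open>
  This is the second-order condition \<open>Tp\<^sub>M \<circ> X = id\<close>: the base component of the velocity of \<open>w\<close> is \<open>w\<close>
  itself.
\<close>

lemma integral_curve_is_lift:
  assumes w: "integral_curve (tangent_atlas A) (dynamical_field A m V \<kappa>) J w"
    and x: "\<And>t. t \<in> J \<Longrightarrow> x t = fst (w t)" and t: "t \<in> J"
  shows "w t = lift A x t"
proof -
  have sw: "smooth_curve (tangent_atlas A) J w" using w by (simp add: integral_curve_def)
  obtain C where C: "C \<in> tangent_atlas A" "w t \<in> fst C" using T.smooth_curve_in_chart[OF sw t] .
  then obtain c where c: "c \<in> A" "C = tangent_chart A c" by (auto simp: tangent_atlas_def)
  have wt: "w t \<in> tangent_bundle A" "fst (w t) \<in> fst c" using C c by (auto simp: fst_tangent_chart)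
  let ?Y = "velocity (tangent_atlas A) w t"
  have "fst (?Y C) = snd (w t) c"
    using dynamical_field_iff_newton[OF wt(1) T.velocity_in_tangent_space[OF sw t] c(1) wt(2)] w t c(2)
    by (simp add: integral_curve_def)
  moreover have W: "has_coord_velocity C w (?Y C) t"
    using T.smooth_curve_coord_velocity[OF sw t C] .
  then have "((\<lambda>s. (snd c (fst (w s)), snd (w s) c)) has_vector_derivative ?Y C) (at t)"
    unfolding has_coord_velocity_def c(2) by (simp only: o_def snd_tangent_chart)
  from bounded_linear.has_vector_derivative[OF bounded_linear_fst this]
  have "((snd c \<circ> (\<lambda>s. fst (w s))) has_vector_derivative fst (?Y C)) (at t)" by (simp add: o_def)
  moreover have "\<forall>\<^sub>F s in nhds t. fst (w s) \<in> fst c"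
    using W[unfolded has_coord_velocity_def, THEN conjunct1]
    by eventually_elim (simp add: c(2) fst_tangent_chart)
  ultimately have "has_coord_velocity c (\<lambda>s. fst (w s)) (snd (w t) c) t"
    by (simp add: has_coord_velocity_def)
  moreover obtain e where e: "e > 0" "ball t e \<subseteq> J" using sw t unfolding smooth_curve_def by blast
  have "\<forall>\<^sub>F s in nhds t. fst (w s) = x s"
    using eventually_nhds_ball[OF e(1), of t] by eventually_elim (use e(2) x in auto)
  ultimately have "has_coord_velocity c x (snd (w t) c) t" by (rule has_coord_velocity_transform)
  then have "velocity A x t = coord_vector A c (x t) (snd (w t) c)"
    by (rule velocity_eq_coord_vector[OF c(1)])
  also have "\<dots> = snd (w t)"
    using coord_vector_of_tangent_vector[OF c(1) wt(2)] wt(1) x[OF t] by (auto simp: tangent_bundle_def)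
  finally show ?thesis using x[OF t] by (simp add: lift_def prod_eq_iff)
qed

lemma motion_iff_lift:
  assumes x: "smooth_curve A J x"
  shows "motion A m V \<kappa> J x \<longleftrightarrow>
    (\<forall>t\<in>J. velocity (tangent_atlas A) (lift A x) t = dynamical_field A m V \<kappa> (lift A x t))"
proof
  assume "motion A m V \<kappa> J x"
  then obtain w where w: "integral_curve (tangent_atlas A) (dynamical_field A m V \<kappa>) J w"
      and wx: "\<And>t. t \<in> J \<Longrightarrow> x t = fst (w t)"
    by (auto simp: motion_def)
  have eq: "w t = lift A x t" if "t \<in> J" for t using integral_curve_is_lift[OF w wx that] .
  show "\<forall>t\<in>J. velocity (tangent_atlas A) (lift A x) t = dynamical_field A m V \<kappa> (lift A x t)"
  proof
    fix t assume t: "t \<in> J"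
    obtain C where C: "C \<in> tangent_atlas A" "lift A x t \<in> fst C"
      using T.smooth_curve_in_chart[OF smooth_curve_lift[OF x] t] .
    obtain e where e: "e > 0" "ball t e \<subseteq> J" using x t by (auto simp: smooth_curve_def)
    have ev: "\<forall>\<^sub>F s in nhds t. w s = lift A x s"
      using eventually_nhds_ball[OF e(1), of t] by eventually_elim (use e(2) eq in blast)
    have L: "has_coord_velocity C (lift A x) (velocity (tangent_atlas A) (lift A x) t C) t"
      using T.smooth_curve_coord_velocity[OF smooth_curve_lift[OF x] t C] .
    have "has_coord_velocity C w (velocity (tangent_atlas A) (lift A x) t C) t"
      by (rule has_coord_velocity_transform[OF L]) (use ev in \<open>auto elim: eventually_mono\<close>)
    then have "velocity (tangent_atlas A) w t = velocity (tangent_atlas A) (lift A x) t"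
      using T.velocity_eq_coord_vector[OF C(1)] L eq[OF t] by metis
    then show "velocity (tangent_atlas A) (lift A x) t = dynamical_field A m V \<kappa> (lift A x t)"
      using w t eq[OF t] by (simp add: integral_curve_def)
  qed
next
  assume "\<forall>t\<in>J. velocity (tangent_atlas A) (lift A x) t = dynamical_field A m V \<kappa> (lift A x t)"
  then have "integral_curve (tangent_atlas A) (dynamical_field A m V \<kappa>) J (lift A x)"
    using smooth_curve_lift[OF x] by (simp add: integral_curve_def)
  then show "motion A m V \<kappa> J x"
    unfolding motion_def by (intro exI[of _ "lift A x"]) (simp add: lift_def)
qed

theorem motion_iff_newton:
  assumes x: "smooth_curve A J x" and c: "\<And>t. t \<in> J \<Longrightarrow> c t \<in> A \<and> x t \<in> fst (c t)"
  shows "motion A m V \<kappa> J x \<longleftrightarrow> (\<forall>t\<in>J. newton_equation A m V \<kappa> (c t) (snd (c t) (x t))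
    (velocity A x t (c t)) (vector_derivative (\<lambda>s. velocity A x s (c t)) (at t)))"
  unfolding motion_iff_lift[OF x]
proof (rule ball_cong[OF refl])
  fix t assume t: "t \<in> J"
  have L: "fst (lift A x t) = x t" "snd (lift A x t) = velocity A x t" by (simp_all add: lift_def)
  show "velocity (tangent_atlas A) (lift A x) t = dynamical_field A m V \<kappa> (lift A x t) \<longleftrightarrow>
    newton_equation A m V \<kappa> (c t) (snd (c t) (x t))
    (velocity A x t (c t)) (vector_derivative (\<lambda>s. velocity A x s (c t)) (at t))"
    using dynamical_field_iff_newton[OF lift_in_tangent_bundle[OF x t]
        T.velocity_in_tangent_space[OF smooth_curve_lift[OF x] t], of "c t"] c[OF t]
      lift_velocity(2)[OF x t, of "c t"] by (simp add: L)
qed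

end

section \<open>Conformal change of the metric\<close>

text \<open>
  On the diagonal the first two terms of the Koszul formula coincide, so the factor 2 can be cancelled.
\<close>

lemma christoffel_pairing:
  fixes A :: "('p, 'e::euclidean_space) chart set"
    and g :: "'p \<Rightarrow> ('p, 'e) tvec \<Rightarrow> ('p, 'e) tvec \<Rightarrow> real" and c :: "('p, 'e) chart"
  defines "B \<equiv> coord_2tensor A g c"
  assumes bil: "\<forall>\<^sub>F q in nhds q. bilinear (B q)"
    and B: "\<And>u v. (\<lambda>q. B q u v) differentiable (at q)"
    and pos: "\<And>u. u \<noteq> 0 \<Longrightarrow> B q u u > 0"
  shows "B q (christoffel A g c q u u) y = \<D> (\<lambda>q. B q u y) q u - 1/2 * \<D> (\<lambda>q. B q u u) q y"
proof -
  let ?r = "\<lambda>y. \<D> (\<lambda>q. B q u y) q u - 1/2 * \<D> (\<lambda>q. B q u u) q y"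
  have l1: "linear (\<lambda>y. \<D> (\<lambda>q. B q u y) q u)"
    by (rule linear_derivative_linear_family[OF eventually_mono[OF bil] B]) (simp add: bilinear_def)
  have l2: "linear (\<D> (\<lambda>q. B q u u) q)" by (rule linear_frechet_derivative[OF B])
  have "linear ?r"
    by (rule linearI)
       (simp_all add: linear_add[OF l1] linear_add[OF l2] linear_scale[OF l1] linear_scale[OF l2] algebra_simps)
  from riesz_representation_bilinear[OF eventually_nhds_x_imp_x[OF bil] pos this]
  have "\<exists>!z. \<forall>y. B q z y = ?r y" .
  moreover have "(\<forall>y. 2 * coord_2tensor A g c q z y =
     \<D> (\<lambda>q. coord_2tensor A g c q u y) q u + \<D> (\<lambda>q. coord_2tensor A g c q u y) q u -
     \<D> (\<lambda>q. coord_2tensor A g c q u u) q y) \<longleftrightarrow> (\<forall>y. B q z y = ?r y)" for z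
    unfolding B_def[symmetric] by (intro arg_cong[of _ _ All] ext) argo
  ultimately show ?thesis
    unfolding christoffel_def using theI'[of "\<lambda>z. \<forall>y. B q z y = ?r y"] by simp
qed

text \<open>
  Rescaling the metric by \<open>\<rho>\<close> and the velocity by \<open>1/\<rho>\<close> turns the gradient of \<open>\<rho>\<close> into a force. The
  terms along \<open>u\<close>, one from the reparameterization and one from differentiating \<open>\<rho>\<close> in the direction of
  the curve, cancel; by \<open>G(u, u) = \<rho>\<close> the remaining one is \<open>-d\<rho>/2\<close>, up to the common factor \<open>1/\<rho>\<close>.
  The second derivative in the new parameter is that of \<open>u / \<rho>\<close> along the curve, again divided by \<open>\<rho>\<close>.
\<close>

lemma geodesic_covector_conformal:
  fixes G :: "'e::euclidean_space \<Rightarrow> 'e \<Rightarrow> 'e \<Rightarrow> real"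
  assumes bil: "\<forall>\<^sub>F q in nhds q. bilinear (G q)"
    and G: "\<And>u v. (\<lambda>q. G q u v) differentiable (at q)"
    and \<rho>: "\<rho> differentiable (at q)"
    and f: "f > 0" "\<rho> q = f" "G q u u = f"
  shows "geodesic_covector (\<lambda>q u v. \<rho> q * G q u v) q (u /\<^sub>R f)
      ((a /\<^sub>R f - (\<D> \<rho> q u / f^2) *\<^sub>R u) /\<^sub>R f) z =
    (geodesic_covector G q u a z - 1/2 * \<D> \<rho> q z) / f"
proof -
  obtain S where S: "open S" "q \<in> S" and B: "\<And>q. q \<in> S \<Longrightarrow> bilinear (G q)"
    using bil unfolding eventually_nhds by blast
  note G' = G[unfolded frechet_derivative_works] and \<rho>' = \<rho>[unfolded frechet_derivative_works]
  have prod: "((\<lambda>q. \<rho> q * G q u v) has_derivative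
      (\<lambda>w. f * \<D> (\<lambda>q. G q u v) q w + \<D> \<rho> q w * G q u v)) (at q)" for u v
    using has_derivative_mult[OF \<rho>' G'] by (simp add: f)
  have d1: "\<D> (\<lambda>q. \<rho> q * G q (u /\<^sub>R f) z) q (u /\<^sub>R f) =
      (f * \<D> (\<lambda>q. G q u z) q u + \<D> \<rho> q u * G q u z) / f^2"
  proof -
    have "((\<lambda>q. \<rho> q * G q (u /\<^sub>R f) z) has_derivative
        (\<lambda>w. (f * \<D> (\<lambda>q. G q u z) q w + \<D> \<rho> q w * G q u z) /\<^sub>R f)) (at q)"
      by (rule has_derivative_transform_within_open[OF has_derivative_scaleR_right[OF prod] S])
         (simp add: bilinear_lmul[OF B])
    from frechet_derivative_at[OF this, symmetric]
      linear_scale[OF linear_frechet_derivative[OF G]] linear_scale[OF linear_frechet_derivative[OF \<rho>]]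
    show ?thesis using f by (simp add: field_simps power2_eq_square)
  qed
  have d2: "\<D> (\<lambda>q. \<rho> q * G q (u /\<^sub>R f) (u /\<^sub>R f)) q z =
      (f * \<D> (\<lambda>q. G q u u) q z + \<D> \<rho> q z * f) / f^2"
  proof -
    have "((\<lambda>q. \<rho> q * G q (u /\<^sub>R f) (u /\<^sub>R f)) has_derivative
        (\<lambda>w. (f * \<D> (\<lambda>q. G q u u) q w + \<D> \<rho> q w * G q u u) /\<^sub>R f /\<^sub>R f)) (at q)"
      by (rule has_derivative_transform_within_open[OF has_derivative_scaleR_right[OF
            has_derivative_scaleR_right[OF prod]] S])
         (simp add: bilinear_lmul[OF B] bilinear_rmul[OF B])
    from frechet_derivative_at[OF this, symmetric] show ?thesis
      using f by (simp add: field_simps power2_eq_square)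
  qed
  have d0: "\<rho> q * G q ((a /\<^sub>R f - (\<D> \<rho> q u / f^2) *\<^sub>R u) /\<^sub>R f) z =
      G q a z / f - \<D> \<rho> q u * G q u z / f^2"
    using f by (simp add: bilinear_lmul[OF B[OF S(2)]] bilinear_lsub[OF B[OF S(2)]] field_simps power2_eq_square)
  show ?thesis
    unfolding geodesic_covector_def d0 d1 d2 using f by (simp add: field_simps power2_eq_square)
qed

section \<open>Curves of constant energy parameterized by Jacobi arclength\<close>

locale constant_energy_curve = gyroscopic A m V \<kappa>
  for A :: "('p, 'e::euclidean_space) chart set"
    and m :: "'p \<Rightarrow> ('p, 'e) tvec \<Rightarrow> ('p, 'e) tvec \<Rightarrow> real"
    and V :: "'p \<Rightarrow> real"
    and \<kappa> :: "'p \<Rightarrow> ('p, 'e) tvec \<Rightarrow> ('p, 'e) tvec \<Rightarrow> real" +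
  fixes h a :: real and J :: "real set" and x :: "real \<Rightarrow> 'p"
  assumes J: "open J" "is_interval J" "a \<in> J"
    and x: "smooth_curve A J x" "x ` J \<subseteq> energy_region A V h"
    and energy: "\<And>t. t \<in> J \<Longrightarrow> 1/2 * m (x t) (velocity A x t) (velocity A x t) + V (x t) = h"
begin

abbreviation "mh \<equiv> jacobi_metric m V h"
abbreviation "jacobi_speed t \<equiv> 2 * (h - V (x t))"
abbreviation "len \<equiv> arclength A mh x a"
abbreviation "y \<equiv> by_arclength A mh J x a"
abbreviation "acc c t \<equiv> vector_derivative (\<lambda>s. velocity A x s c) (at t)"

lemma speed_pos: "t \<in> J \<Longrightarrow> jacobi_speed t > 0"
  using x(2) by (auto simp: energy_region_def)

lemma velocity_squared: "t \<in> J \<Longrightarrow> m (x t) (velocity A x t) (velocity A x t) = jacobi_speed t"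
  using energy[of t] by simp

lemma jacobi_norm_velocity: "t \<in> J \<Longrightarrow> metric_norm mh (x t) (velocity A x t) = jacobi_speed t"
  using speed_pos[of t] by (simp add: metric_norm_def jacobi_metric_def velocity_squared)

lemma speed_has_derivative:
  assumes t: "t \<in> J" and c: "c \<in> A" "x t \<in> fst c"
  shows "(jacobi_speed has_real_derivative - 2 * \<D> (V \<circ> chart_inv c) (snd c (x t)) (velocity A x t c)) (at t)"
proof -
  have W: "\<forall>\<^sub>F s in nhds t. x s \<in> fst c" "((snd c \<circ> x) has_derivative (\<lambda>r. r *\<^sub>R velocity A x t c)) (at t)"
    using smooth_curve_coord_velocity[OF x(1) t c]
    by (auto simp: has_coord_velocity_def has_vector_derivative_def)
  have q: "snd c (x t) \<in> snd c ` fst c" using c by simp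
  note V' = potential_has_derivative[OF c(1) q]
  have "((\<lambda>s. (V \<circ> chart_inv c) ((snd c \<circ> x) s)) has_derivative
      (\<lambda>r. \<D> (V \<circ> chart_inv c) (snd c (x t)) (r *\<^sub>R velocity A x t c))) (at t)"
    by (rule has_derivative_compose[OF W(2), where g = "V \<circ> chart_inv c"])
       (simp only: o_apply[of "snd c" x], rule V')
  then have "((\<lambda>s. (V \<circ> chart_inv c) ((snd c \<circ> x) s)) has_real_derivative
      \<D> (V \<circ> chart_inv c) (snd c (x t)) (velocity A x t c)) (at t)"
    unfolding has_field_derivative_def
    by (rule has_derivative_eq_rhs) (simp add: fun_eq_iff linear_scale[OF has_derivative_linear[OF V']])
  then have "((\<lambda>s. 2 * (h - (V \<circ> chart_inv c) ((snd c \<circ> x) s))) has_real_derivative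
      - 2 * \<D> (V \<circ> chart_inv c) (snd c (x t)) (velocity A x t c)) (at t)"
    by (auto intro!: derivative_eq_intros)
  moreover have "\<forall>\<^sub>F s in nhds t. 2 * (h - (V \<circ> chart_inv c) ((snd c \<circ> x) s)) = jacobi_speed s"
    using W(1) by eventually_elim (simp add: chart_inv_snd c)
  ultimately show ?thesis
    by (subst (asm) DERIV_cong_ev[OF refl _ refl]) auto
qed

lemma continuous_on_speed: "continuous_on J jacobi_speed"
proof (rule continuous_at_imp_continuous_on, rule ballI)
  fix t assume t: "t \<in> J"
  obtain c where "c \<in> A" "x t \<in> fst c" using smooth_curve_in_chart[OF x(1) t] .
  from speed_has_derivative[OF t this] show "isCont jacobi_speed t" by (rule DERIV_isCont)
qed

text \<open>
  The curve is controlled only on \<open>J\<close>, so the fundamental theorem of calculus is used on a compact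
  interval in \<open>J\<close> that has \<open>t\<close> in its interior and contains \<open>a\<close>.
\<close>

lemma len_has_derivative:
  assumes t: "t \<in> J"
  shows "(len has_real_derivative jacobi_speed t) (at t)"
proof -
  obtain e where e: "e > 0" "ball t e \<subseteq> J" using J(1) t openE by blast
  obtain e' where e': "e' > 0" "ball a e' \<subseteq> J" using J(1,3) openE by blast
  define l r where "l = min (t - e/2) (a - e'/2)" and "r = max (t + e/2) (a + e'/2)"
  have "l \<in> J" "r \<in> J" using e e' by (auto simp: l_def r_def min_def max_def subset_iff dist_real_def)
  from mem_is_interval_1_I[OF J(2) this] have lr: "{l..r} \<subseteq> J" by auto
  have lt: "l < t" "t < r" "l \<le> a" "a \<le> r" using e(1) e'(1) by (auto simp: l_def r_def)
  have "continuous_on {l..r} (\<lambda>u. metric_norm mh (x u) (velocity A x u))"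
    using continuous_on_subset[OF continuous_on_speed lr] lr jacobi_norm_velocity
    by (subst continuous_on_cong[OF refl, where g = jacobi_speed]) auto
  from interval_integral_FTC2[OF lt(3,4) this, of t] lt
  have "(len has_vector_derivative jacobi_speed t) (at t within {l..r})"
    using jacobi_norm_velocity[OF t] by (simp add: arclength_def[abs_def])
  then show ?thesis
    using lt by (simp add: has_real_derivative_iff_has_vector_derivative at_within_Icc_at)
qed

lemma inj_on_len: "inj_on len J"
proof -
  have "len s < len t" if "s \<in> J" "t \<in> J" "s < t" for s t
  proof (rule DERIV_pos_imp_increasing[OF that(3)])
    fix u assume "s \<le> u" "u \<le> t"
    then have "u \<in> J" using mem_is_interval_1_I[OF J(2) that(1,2)] by blast
    then show "\<exists>d. DERIV len u :> d \<and> d > 0" using len_has_derivative speed_pos by blast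
  qed
  then show ?thesis by (metis inj_onI less_irrefl linorder_neqE)
qed

lemma inv_len: "t \<in> J \<Longrightarrow> inv_into J len (len t) = t"
  using inj_on_len by (rule inv_into_f_f)

lemma by_arclength_len: "t \<in> J \<Longrightarrow> y (len t) = x t"
  by (simp add: by_arclength_def inv_len)

lemma open_len_image: "open (len ` J)"
proof (rule invariance_of_domain[OF _ J(1) inj_on_len])
  show "continuous_on J len"
    using len_has_derivative DERIV_isCont continuous_at_imp_continuous_on by blast
qed

lemma inv_len_has_derivative:
  assumes t: "t \<in> J"
  shows "(inv_into J len has_real_derivative 1 / jacobi_speed t) (at (len t))"
proof -
  have "(inv_into J len has_derivative (\<lambda>r. r / jacobi_speed t)) (at (len t))"
  proof (rule has_derivative_inverse_strong[OF J(1) t])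
    show "continuous_on J len"
      using len_has_derivative DERIV_isCont continuous_at_imp_continuous_on by blast
    show "(len has_derivative (*) (jacobi_speed t)) (at t)"
      using len_has_derivative[OF t] by (simp add: has_field_derivative_def)
    show "(*) (jacobi_speed t) \<circ> (\<lambda>r. r / jacobi_speed t) = id" using speed_pos[OF t] by auto
  qed (rule inv_len)
  then show ?thesis
    unfolding has_field_derivative_def by (rule has_derivative_eq_rhs) (simp add: fun_eq_iff)
qed

lemma by_arclength_coord_velocity:
  assumes t: "t \<in> J" and c: "c \<in> A" "x t \<in> fst c"
  shows "has_coord_velocity c y (velocity A x t c /\<^sub>R jacobi_speed t) (len t)"
proof -
  have W: "\<forall>\<^sub>F s in nhds t. x s \<in> fst c" "((snd c \<circ> x) has_vector_derivative velocity A x t c) (at t)"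
    using smooth_curve_coord_velocity[OF x(1) t c] by (auto simp: has_coord_velocity_def)
  have "((\<lambda>\<sigma>. inv_into J len \<sigma>) \<longlongrightarrow> t) (nhds (len t))"
    using DERIV_isCont[OF inv_len_has_derivative[OF t]] inv_len[OF t]
    by (metis isCont_def tendsto_at_iff_tendsto_nhds)
  then have "\<forall>\<^sub>F \<sigma> in nhds (len t). y \<sigma> \<in> fst c"
    using eventually_compose_filterlim[OF W(1)] by (simp add: by_arclength_def)
  moreover have "((snd c \<circ> x) \<circ> inv_into J len has_vector_derivative (1 / jacobi_speed t) *\<^sub>R velocity A x t c) (at (len t))"
    by (rule vector_diff_chain_at)
       (use inv_len_has_derivative[OF t] W(2) inv_len[OF t] in
         \<open>simp_all add: has_real_derivative_iff_has_vector_derivative\<close>)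
  ultimately show ?thesis
    by (simp add: has_coord_velocity_def by_arclength_def[abs_def] o_def inverse_eq_divide)
qed

lemma by_arclength_velocity:
  assumes "t \<in> J" "c \<in> A" "x t \<in> fst c"
  shows "velocity A y (len t) = coord_vector A c (x t) (velocity A x t c /\<^sub>R jacobi_speed t)"
  using velocity_eq_coord_vector[OF assms(2) by_arclength_coord_velocity[OF assms]]
  by (simp add: by_arclength_len assms(1))

text \<open>
  The velocity in the new parameter is \<open>x' / f\<close> with \<open>f = 2(h - V)\<close> also near the given point, and the
  quotient rule is followed by the chain rule for the inverse of the arclength.
\<close>

lemma by_arclength_acceleration:
  assumes t: "t \<in> J" and c: "c \<in> A" "x t \<in> fst c"
  shows "vector_derivative (\<lambda>\<sigma>. velocity A y \<sigma> c) (at (len t)) =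
    (acc c t /\<^sub>R jacobi_speed t - (- 2 * \<D> (V \<circ> chart_inv c) (snd c (x t)) (velocity A x t c) / (jacobi_speed t)^2)
       *\<^sub>R velocity A x t c) /\<^sub>R jacobi_speed t"
    (is "_ = ?a /\<^sub>R jacobi_speed t")
proof -
  let ?w = "\<lambda>s. inverse (jacobi_speed s) *\<^sub>R velocity A x s c"
  have "(?w has_vector_derivative ?a) (at t)"
  proof -
    have 1: "((\<lambda>s. inverse (jacobi_speed s)) has_real_derivative
        - (inverse (jacobi_speed t) * (- 2 * \<D> (V \<circ> chart_inv c) (snd c (x t)) (velocity A x t c)) * inverse (jacobi_speed t))) (at t)"
      using speed_pos[OF t] by (intro DERIV_inverse' speed_has_derivative[OF t c]) simp
    have "inverse f *\<^sub>R b + (- (inverse f * D * inverse f)) *\<^sub>R u = b /\<^sub>R f - (D / f^2) *\<^sub>R u"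
      for f D :: real and b u :: 'e
      by (simp add: divide_inverse power2_eq_square mult_ac)
    then show ?thesis
      by (rule has_vector_derivative_eq_rhs[OF has_vector_derivative_scaleR[OF 1 lift_velocity(1)[OF x(1) t c]]])
  qed
  then have "(?w \<circ> inv_into J len has_vector_derivative (1 / jacobi_speed t) *\<^sub>R ?a) (at (len t))"
    by (intro vector_diff_chain_at)
       (use inv_len_has_derivative[OF t] inv_len[OF t] in
         \<open>simp_all add: has_real_derivative_iff_has_vector_derivative\<close>)
  moreover have "\<forall>\<^sub>F \<sigma> in nhds (len t). (?w \<circ> inv_into J len) \<sigma> = velocity A y \<sigma> c"
  proof -
    have "\<forall>\<^sub>F \<sigma> in nhds (len t). y \<sigma> \<in> fst c"
      using by_arclength_coord_velocity[OF t c] by (simp add: has_coord_velocity_def)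
    moreover have "\<forall>\<^sub>F \<sigma> in nhds (len t). \<sigma> \<in> len ` J"
      using open_len_image t by (intro eventually_nhds_in_open) auto
    ultimately show ?thesis
    proof eventually_elim
      case (elim \<sigma>)
      then obtain s where s: "s \<in> J" "\<sigma> = len s" by blast
      with elim(1) have "x s \<in> fst c" by (simp add: by_arclength_len)
      with s show ?case
        using by_arclength_velocity[OF s(1) c(1)] by (simp add: inv_len coord_vector_self c(1))
    qed
  qed
  ultimately have "((\<lambda>\<sigma>. velocity A y \<sigma> c) has_vector_derivative (1 / jacobi_speed t) *\<^sub>R ?a) (at (len t))"
    unfolding has_vector_derivative_def
    by (rule has_derivative_transform_nhds)
  from vector_derivative_at[OF this] show ?thesis by (simp add: inverse_eq_divide)
qed

lemma jacobi_metric_coords: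
  "coord_2tensor A mh c = (\<lambda>q u v. 2 * (h - (V \<circ> chart_inv c) q) * coord_2tensor A m c q u v)"
  by (simp add: fun_eq_iff coord_2tensor_def jacobi_metric_def)

lemma jacobi_metric_bilinear:
  assumes "c \<in> A" "q \<in> snd c ` fst c"
  shows "bilinear (coord_2tensor A mh c q)"
  unfolding jacobi_metric_coords bilinear_def
  by (intro conjI allI linearI)
     (simp_all add: bilinear_ladd[OF metric_bilinear[OF assms]] bilinear_radd[OF metric_bilinear[OF assms]]
       bilinear_lmul[OF metric_bilinear[OF assms]] bilinear_rmul[OF metric_bilinear[OF assms]] algebra_simps)

lemma jacobi_metric_differentiable:
  assumes "c \<in> A" "q \<in> snd c ` fst c"
  shows "(\<lambda>q. coord_2tensor A mh c q u v) differentiable (at q)"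
proof -
  have "(V \<circ> chart_inv c) differentiable (at q)"
    using potential_has_derivative[OF assms] unfolding differentiable_def by blast
  then show ?thesis
    unfolding jacobi_metric_coords
    by (intro differentiable_mult differentiable_diff differentiable_const metric_differentiable[OF assms])
qed

text \<open>
  The coordinates of the curvature vector, taken in the chart around the point in which the covariant
  derivative is computed.
\<close>

definition curv :: "real \<Rightarrow> 'e" where
  "curv t = (let c = chart_at A (x t) in
     vector_derivative (\<lambda>\<sigma>. velocity A y \<sigma> c) (at (len t)) +
     christoffel A mh c (snd c (x t)) (velocity A x t c /\<^sub>R jacobi_speed t) (velocity A x t c /\<^sub>R jacobi_speed t))"

lemma curvature_vector_coords:
  assumes t: "t \<in> J" "x t \<in> points A"
  shows "curvature_vector A mh y (len t) = coord_vector A (chart_at A (x t)) (x t) (curv t)"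
  using by_arclength_velocity[OF t(1) chart_at[OF t(2)]] coord_vector_self[OF chart_at[OF t(2)]]
  by (simp add: curvature_vector_def covariant_derivative_def Let_def by_arclength_len t(1) curv_def)

text \<open>
  The curvature vector is the Levi-Civita acceleration of \<open>m\<^sub>h\<close>, and \<open>m\<^sub>h\<close> is the rescaling of \<open>m\<close> by
  \<open>\<rho> = 2(h - V)\<close>, so that \<open>-d\<rho>/2 = dV\<close>.
\<close>

lemma curvature_pairing:
  assumes t: "t \<in> J" "x t \<in> points A"
  defines "c \<equiv> chart_at A (x t)"
  defines "q \<equiv> snd c (x t)" and "u \<equiv> velocity A x t c"
  shows "coord_2tensor A mh c q (curv t) z =
    (geodesic_covector (coord_2tensor A m c) q u (acc c t) z + \<D> (V \<circ> chart_inv c) q z) / jacobi_speed t"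
proof -
  let ?f = "jacobi_speed t" and ?\<rho> = "\<lambda>q. 2 * (h - (V \<circ> chart_inv c) q)" and ?g = "coord_2tensor A mh c"
  let ?a = "vector_derivative (\<lambda>\<sigma>. velocity A y \<sigma> c) (at (len t))"
  have c: "c \<in> A" "x t \<in> fst c" using chart_at[OF t(2)] by (simp_all add: c_def)
  have q: "q \<in> snd c ` fst c" using c by (simp add: q_def)
  have p: "chart_inv c q = x t" using c by (simp add: q_def chart_inv_snd)
  have "\<forall>\<^sub>F q in nhds q. q \<in> snd c ` fst c"
    using eventually_nhds_in_open[OF open_chart_image[OF c(1)] q] .
  then have bil: "\<forall>\<^sub>F q in nhds q. bilinear (?g q)"
    by eventually_elim (rule jacobi_metric_bilinear[OF c(1)])
  have pos: "?g q u u > 0" if "u \<noteq> 0" for u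
    using metric_positive[OF c(1) q that] speed_pos[OF t(1)] p by (simp add: jacobi_metric_coords)
  have \<rho>: "(?\<rho> has_derivative (\<lambda>w. - 2 * \<D> (V \<circ> chart_inv c) q w)) (at q)"
    by (rule has_derivative_eq_rhs[OF has_derivative_mult_right[OF has_derivative_diff[OF
            has_derivative_const potential_has_derivative[OF c(1) q]]]]) (simp add: fun_eq_iff)
  have D\<rho>: "\<D> ?\<rho> q w = - 2 * \<D> (V \<circ> chart_inv c) q w" for w
    by (simp only: frechet_derivative_at[OF \<rho>, symmetric])
  have u: "coord_vector A c (x t) u = velocity A x t"
    using coord_vector_of_tangent_vector[OF c velocity_in_tangent_space[OF x(1) t(1)]] by (simp add: u_def)
  have "?g q (curv t) z = ?g q ?a z + ?g q (christoffel A mh c q (u /\<^sub>R ?f) (u /\<^sub>R ?f)) z"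
    unfolding curv_def Let_def c_def[symmetric] q_def[symmetric] u_def[symmetric]
    by (rule bilinear_ladd[OF jacobi_metric_bilinear[OF c(1) q]])
  also have "\<dots> = geodesic_covector ?g q (u /\<^sub>R ?f) ?a z"
    using christoffel_pairing[OF bil jacobi_metric_differentiable[OF c(1) q] pos, of "u /\<^sub>R ?f" z]
    by (simp add: geodesic_covector_def)
  also have "\<dots> = (geodesic_covector (coord_2tensor A m c) q u (acc c t) z - 1/2 * \<D> ?\<rho> q z) / ?f"
  proof -
    have "?a = (acc c t /\<^sub>R ?f - (\<D> ?\<rho> q u / ?f^2) *\<^sub>R u) /\<^sub>R ?f"
      unfolding D\<rho> unfolding q_def u_def by (rule by_arclength_acceleration[OF t(1) c])
    moreover have "coord_2tensor A m c q u u = ?f"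
      using velocity_squared[OF t(1)] by (simp add: coord_2tensor_def p u)
    ultimately show ?thesis
      unfolding jacobi_metric_coords
      using geodesic_covector_conformal[OF metric_eventually_bilinear[OF c(1) q] metric_differentiable[OF c(1) q],
          of ?\<rho> ?f u "acc c t" z] speed_pos[OF t(1)] \<rho> p
      by (auto simp: differentiable_def)
  qed
  also have "\<dots> = (geodesic_covector (coord_2tensor A m c) q u (acc c t) z + \<D> (V \<circ> chart_inv c) q z) / ?f"
    unfolding D\<rho> by simp
  finally show ?thesis .
qed

text \<open>
  The derivative of the constant energy along the curve is the Euler-Lagrange covector paired with the
  velocity, and this covector is a multiple of the curvature.
\<close>

lemma curvature_orthogonal:
  assumes t: "t \<in> J" "x t \<in> points A"
  defines "c \<equiv> chart_at A (x t)"
  defines "q \<equiv> snd c (x t)" and "u \<equiv> velocity A x t c"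
  shows "coord_2tensor A mh c q (curv t) u = 0"
proof -
  let ?G = "coord_2tensor A m c" and ?q = "\<lambda>s. snd c (x s)" and ?u = "\<lambda>s. velocity A x s c"
  have c: "c \<in> A" "x t \<in> fst c" using chart_at[OF t(2)] by (simp_all add: c_def)
  have q: "q \<in> snd c ` fst c" using c by (simp add: q_def)
  have W: "\<forall>\<^sub>F s in nhds t. x s \<in> fst c" "(?q has_derivative (\<lambda>r. r *\<^sub>R u)) (at t)"
    using smooth_curve_coord_velocity[OF x(1) t(1) c]
    by (auto simp: has_coord_velocity_def has_vector_derivative_def u_def o_def)
  have u': "(?u has_derivative (\<lambda>r. r *\<^sub>R acc c t)) (at t)"
    using lift_velocity(1)[OF x(1) t(1) c] by (simp add: has_vector_derivative_def)
  have G: "((\<lambda>s. ?G (?q s) v w) has_derivative (\<lambda>r. \<D> (\<lambda>q. ?G q v w) q (r *\<^sub>R u))) (at t)" for v w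
    using metric_differentiable[OF c(1) q]
    by (intro has_derivative_compose[OF W(2)]) (simp add: q_def frechet_derivative_works)
  have "\<forall>\<^sub>F s in nhds t. bilinear (?G (?q s))"
    using W(1) by eventually_elim (auto intro!: metric_bilinear c)
  then have "((\<lambda>s. ?G (?q s) (?u s) (?u s)) has_derivative
      (\<lambda>r. \<D> (\<lambda>s. ?G (?q s) (?u t) (?u t)) t r + ?G (?q t) (r *\<^sub>R acc c t) (?u t) + ?G (?q t) (?u t) (r *\<^sub>R acc c t))) (at t)"
    using G by (intro has_derivative_bilinear_family u') (auto simp: differentiable_def)
  then have "((\<lambda>s. ?G (?q s) (?u s) (?u s)) has_derivative
      (\<lambda>r. r * (\<D> (\<lambda>q. ?G q u u) q u + 2 * ?G q (acc c t) u))) (at t)"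
    by (rule has_derivative_eq_rhs)
       (simp add: fun_eq_iff frechet_derivative_at[OF G, symmetric] bilinear_lmul[OF metric_bilinear[OF c(1) q]]
          bilinear_rmul[OF metric_bilinear[OF c(1) q]] metric_symmetric[OF c(1) q, of u]
          linear_scale[OF linear_frechet_derivative[OF metric_differentiable[OF c(1) q]]] algebra_simps
          flip: u_def q_def)
  moreover have "\<forall>\<^sub>F s in nhds t. ?G (?q s) (?u s) (?u s) = jacobi_speed s"
    using W(1) eventually_nhds_in_open[OF J(1) t(1)]
  proof eventually_elim
    case (elim s)
    then show ?case
      using coord_vector_of_tangent_vector[OF c(1) elim(1) velocity_in_tangent_space[OF x(1) elim(2)]] c
        velocity_squared by (simp add: coord_2tensor_def chart_inv_snd)
  qed
  ultimately have "(jacobi_speed has_real_derivative (\<D> (\<lambda>q. ?G q u u) q u + 2 * ?G q (acc c t) u)) (at t)"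
    unfolding has_field_derivative_def
    by (intro has_derivative_transform_nhds[where g = jacobi_speed]) (simp_all add: mult_commute_abs)
  from DERIV_unique[OF this speed_has_derivative[OF t(1) c]]
  show ?thesis
    using curvature_pairing[OF t, of u]
    by (simp add: geodesic_covector_def flip: c_def q_def u_def)
qed

end

section \<open>Area forms and orientation in the plane\<close>

lemma inverse_square_cancel: "r > 0 \<Longrightarrow> inverse r * (inverse r * (r * r)) = (1 :: real)"
  by (simp add: field_simps)

lemma orthonormal_frame_completion:
  fixes B :: "real^2 \<Rightarrow> real^2 \<Rightarrow> real"
  assumes B: "bilinear B" and sym: "\<And>u v. B u v = B v u" and pos: "\<And>u. u \<noteq> 0 \<Longrightarrow> B u u > 0"
    and v: "B v v = 1"
  obtains n where "B n n = 1" "B n v = 0" "\<And>z. z = B z n *\<^sub>R n + B z v *\<^sub>R v"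
proof -
  note [simp] = bilinear_ladd[OF B] bilinear_radd[OF B] bilinear_lmul[OF B] bilinear_rmul[OF B]
    bilinear_lsub[OF B] bilinear_rsub[OF B] bilinear_lzero[OF B] bilinear_rzero[OF B]
  \<comment> \<open>Rotate \<open>v\<close> by a right angle for the Euclidean structure, then make it orthonormal for \<open>B\<close>.\<close>
  define J where "J = (vector [- v $ 2, v $ 1] :: real^2)"
  define w where "w = J - B J v *\<^sub>R v"
  define r where "r = sqrt (B w w)"
  have J: "J $ 1 = - v $ 2" "J $ 2 = v $ 1" by (simp_all add: J_def)
  have "v \<noteq> 0" using v by force
  then have v2: "v $ 1 * v $ 1 + v $ 2 * v $ 2 \<noteq> 0"
    by (simp add: vec_eq_iff forall_2 sum_squares_eq_zero_iff)
  have "w \<noteq> 0"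
  proof
    assume "w = 0"
    then have *: "J $ i = B J v * v $ i" for i by (simp add: w_def vec_eq_iff)
    have "v $ 1 * v $ 1 + v $ 2 * v $ 2 = J $ 2 * v $ 1 - J $ 1 * v $ 2" by (simp add: J)
    also have "\<dots> = 0" using *[of 1] *[of 2] by simp
    finally show False using v2 by simp
  qed
  then have r: "r > 0" "r * r = B w w" using pos[of w] by (simp_all add: r_def)
  define n where "n = w /\<^sub>R r"
  have wv: "B w v = 0" using v by (simp add: w_def)
  have n: "B n n = 1" "B n v = 0" using r(1) by (simp_all add: n_def wv inverse_square_cancel flip: r(2))
  moreover have "z = B z n *\<^sub>R n + B z v *\<^sub>R v" for z
  proof -
    define s where "s = v $ 1 * v $ 1 + v $ 2 * v $ 2"
    define \<alpha> \<beta> where "\<alpha> = (z $ 1 * v $ 1 + z $ 2 * v $ 2) / s" and "\<beta> = (z $ 2 * v $ 1 - z $ 1 * v $ 2) / s"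
    have s: "s \<noteq> 0" using v2 by (simp add: s_def)
    have "s * z $ i = s * (\<alpha> *\<^sub>R v + \<beta> *\<^sub>R J) $ i" for i
    proof -
      have "s * z $ i = (z $ 1 * v $ 1 + z $ 2 * v $ 2) * v $ i + (z $ 2 * v $ 1 - z $ 1 * v $ 2) * J $ i"
        using exhaust_2[of i] by (auto simp: s_def J algebra_simps)
      also have "\<dots> = s * (\<alpha> *\<^sub>R v + \<beta> *\<^sub>R J) $ i" using s by (simp add: \<alpha>_def \<beta>_def field_simps)
      finally show ?thesis .
    qed
    then have "z = \<alpha> *\<^sub>R v + \<beta> *\<^sub>R J" using s by (simp add: vec_eq_iff)
    also have "J = r *\<^sub>R n + B J v *\<^sub>R v" using r by (simp add: n_def w_def)
    finally have z: "z = (\<beta> * r) *\<^sub>R n + (\<alpha> + \<beta> * B J v) *\<^sub>R v" by (simp add: algebra_simps)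
    have "B z n = \<beta> * r" "B z v = \<alpha> + \<beta> * B J v"
      unfolding z using n v sym[of v n] by simp_all
    with z show ?thesis by simp
  qed
  ultimately show thesis using that by blast
qed

locale planar_frame =
  fixes B :: "real^2 \<Rightarrow> real^2 \<Rightarrow> real" and n v :: "real^2"
  assumes B: "bilinear B" and sym: "B u w = B w u"
    and frame: "B n n = 1" "B v v = 1" "B n v = 0" "z = B z n *\<^sub>R n + B z v *\<^sub>R v"
begin

text \<open>
  The area form of \<open>B\<close> for which \<open>(n, v)\<close> is positively oriented.
\<close>

definition area :: "real^2 \<Rightarrow> real^2 \<Rightarrow> real" where
  "area u w = B u n * B w v - B u v * B w n"

lemma bilinear_area: "bilinear area"
  unfolding area_def bilinear_def
  by (intro conjI allI linearI)
     (simp_all add: bilinear_ladd[OF B] bilinear_lmul[OF B] algebra_simps)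

lemma inner_eq_components: "B u w = B u n * B w n + B u v * B w v"
proof -
  have "B u w = B u (B w n *\<^sub>R n + B w v *\<^sub>R v)" using frame(4)[of w] by simp
  then show ?thesis by (simp add: bilinear_radd[OF B] bilinear_rmul[OF B] mult.commute)
qed

text \<open>This is Lagrange's identity for the components in the frame.\<close>

lemma area_orthonormal:
  assumes "B u u = 1" "B w w = 1" "B u w = 0"
  shows "\<bar>area u w\<bar> = 1"
proof -
  have "area u w * area u w = B u u * B w w - B u w * B u w"
    unfolding area_def inner_eq_components[of u u] inner_eq_components[of w w] inner_eq_components[of u w]
    by (simp add: algebra_simps)
  then have "area u w ^ 2 = 1" using assms by (simp add: power2_eq_square)
  then show ?thesis using abs_square_eq_1 by blast
qed

lemma alternating_form_eq:
  assumes K: "bilinear K" and alt: "\<And>u. K u u = (0 :: real)"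
  shows "K u w = K n v * area u w"
proof -
  note K' = bilinear_ladd[OF K] bilinear_radd[OF K] bilinear_lmul[OF K] bilinear_rmul[OF K]
  have anti: "K v n = - K n v"
    using alt[of "n + v"] unfolding K'(1,2) by (simp add: alt)
  have "K u w = K (B u n *\<^sub>R n + B u v *\<^sub>R v) (B w n *\<^sub>R n + B w v *\<^sub>R v)"
    using frame(4)[of u] frame(4)[of w] by simp
  also have "\<dots> = K n v * area u w" by (simp add: K' alt anti area_def algebra_simps)
  finally show ?thesis .
qed

text \<open>
  As \<open>k\<close> is orthogonal to \<open>v\<close> it is \<open>r n\<close>, and the left-hand side says that the number \<open>r\<close> equals
  \<open>K(n, v)\<close>. The right-hand side expresses this by the absolute value and, when it is not zero, the
  sign.
\<close>

lemma magnetic_curvature_iff: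
  assumes K: "bilinear K" and alt: "\<And>u. K u u = (0 :: real)" and k: "B k v = 0"
  shows "(\<forall>z. B k z = - K v z) \<longleftrightarrow>
    sqrt (B k k) = \<bar>K n v\<bar> \<and> (K n v \<noteq> 0 \<longrightarrow> K k v > 0)"
proof -
  define r where "r = B k n"
  have Bk: "B k z = r * B z n" for z using inner_eq_components[of k z] k by (simp add: r_def)
  have Kv: "- K v z = K n v * B z n" for z
    using alternating_form_eq[OF K alt, of v z] frame sym[of v n] by (simp add: area_def)
  have "(\<forall>z. B k z = - K v z) \<longleftrightarrow> r = K n v"
    unfolding Bk Kv using frame(1) by (metis mult.right_neutral)
  moreover have "sqrt (B k k) = \<bar>r\<bar>" using Bk[of k] by (simp add: r_def)
  moreover have "K k v = r * K n v"
    using alternating_form_eq[OF K alt, of k v] frame k by (simp add: area_def r_def)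
  ultimately show ?thesis
    by (auto simp: abs_if zero_less_mult_iff split: if_splits)
qed

end

text \<open>
  Every area form takes one of the values \<open>1\<close> and \<open>-1\<close> on an orthonormal frame, so the ratio can be
  read off there.
\<close>

lemma abs_form_ratio_eq:
  fixes A :: "('p, real^2) chart set"
  assumes A: "differentiable_atlas A" and c: "c \<in> A" "p \<in> fst c"
    and frame: "planar_frame (coord_2tensor A g c (snd c p)) n v"
    and K: "bilinear (coord_2tensor A \<kappa> c (snd c p))" "\<And>u. coord_2tensor A \<kappa> c (snd c p) u u = 0"
  shows "abs_form_ratio A g \<kappa> p = \<bar>coord_2tensor A \<kappa> c (snd c p) n v\<bar>"
    and "nonzero_form_at A \<kappa> p \<longleftrightarrow> coord_2tensor A \<kappa> c (snd c p) n v \<noteq> 0"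
proof -
  interpret differentiable_atlas A by fact
  let ?B = "coord_2tensor A g c (snd c p)" and ?K = "coord_2tensor A \<kappa> c (snd c p)"
  interpret planar_frame ?B n v by fact
  let ?E = "coord_vector A c p"
  have g: "g p (?E u) (?E w) = ?B u w" and \<kappa>: "\<kappa> p (?E u) (?E w) = ?K u w" for u w
    by (simp_all add: coord_2tensor_def chart_inv_snd c)
  define \<omega> where "\<omega> \<xi> \<eta> = area (\<xi> c) (\<eta> c)" for \<xi> \<eta> :: "('p, real^2) tvec"
  have \<omega>: "\<omega> (?E u) (?E w) = area u w" for u w by (simp add: \<omega>_def coord_vector_self c)
  have "area_form_at A g p \<omega>"
    unfolding area_form_at_def ball_tangent_space[OF c] g \<omega>
  proof (intro conjI ballI allI impI)
    fix d assume d: "d \<in> A" "p \<in> fst d"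
    have l: "linear (\<D> (transition d c) (snd d p))" using transition_linear d c by blast
    show "bilinear (\<lambda>u w. \<omega> (coord_vector A d p u) (coord_vector A d p w))"
      unfolding \<omega>_def coord_vector_apply[OF c] bilinear_def
      by (intro conjI allI linearI)
         (simp_all add: linear_add[OF l] linear_scale[OF l] bilinear_ladd[OF bilinear_area]
           bilinear_radd[OF bilinear_area] bilinear_lmul[OF bilinear_area] bilinear_rmul[OF bilinear_area])
  qed (use area_orthonormal in \<open>auto simp: area_def\<close>)
  moreover have "\<kappa> p \<xi> \<eta> = ?K n v * \<omega> \<xi> \<eta>" if "\<xi> \<in> tangent_space A p" "\<eta> \<in> tangent_space A p" for \<xi> \<eta>
    using \<kappa>[of "\<xi> c" "\<eta> c"] coord_vector_of_tangent_vector[OF c] that alternating_form_eq[OF K, of "\<xi> c" "\<eta> c"]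
    by (simp add: \<omega>_def)
  ultimately have ex: "\<exists>\<omega> k. area_form_at A g p \<omega> \<and>
     (\<forall>\<xi>\<in>tangent_space A p. \<forall>\<eta>\<in>tangent_space A p. \<kappa> p \<xi> \<eta> = k * \<omega> \<xi> \<eta>) \<and> \<bar>?K n v\<bar> = \<bar>k\<bar>"
    by blast
  have uniq: "\<bar>k\<bar> = \<bar>?K n v\<bar>" if \<omega>': "area_form_at A g p \<omega>'"
    and k: "\<forall>\<xi>\<in>tangent_space A p. \<forall>\<eta>\<in>tangent_space A p. \<kappa> p \<xi> \<eta> = k * \<omega>' \<xi> \<eta>" for \<omega>' k
  proof -
    have "\<bar>\<omega>' (?E n) (?E v)\<bar> = 1"
      using \<omega>' coord_vector_in_tangent_space[OF c] frame(1-3) unfolding area_form_at_def by (simp add: g)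
    moreover have "?K n v = k * \<omega>' (?E n) (?E v)"
      using k coord_vector_in_tangent_space[OF c] \<kappa> by metis
    ultimately show ?thesis by (simp add: abs_mult)
  qed
  show "abs_form_ratio A g \<kappa> p = \<bar>?K n v\<bar>"
    unfolding abs_form_ratio_def using ex uniq by (intro the_equality) (blast, metis)
  have "\<not> (\<forall>\<xi>\<in>tangent_space A p. \<forall>\<eta>\<in>tangent_space A p. \<kappa> p \<xi> \<eta> = 0) \<longleftrightarrow> ?K n v \<noteq> 0"
    unfolding ball_tangent_space[OF c] \<kappa> using alternating_form_eq[OF K] by (metis mult_zero_left)
  then show "nonzero_form_at A \<kappa> p \<longleftrightarrow> ?K n v \<noteq> 0"
    unfolding nonzero_form_at_def by blast
qed

section \<open>Motions and geodesic curvature\<close>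

theorem proposition5:
  fixes A :: "('p, real^2) chart set"
    and m \<kappa> :: "'p \<Rightarrow> ('p, real^2) tvec \<Rightarrow> ('p, real^2) tvec \<Rightarrow> real"
    and V :: "'p \<Rightarrow> real"
    and h a :: real
    and J :: "real set"
    and x :: "real \<Rightarrow> 'p"
  assumes system: "gyroscopic_system A m V \<kappa>"
    and nonempty: "energy_region A V h \<noteq> {}"
    and interval: "open J" "is_interval J" "a \<in> J"
    and curve: "smooth_curve A J x" "x ` J \<subseteq> energy_region A V h"
    and energy: "\<And>t. t \<in> J \<Longrightarrow>
      1/2 * m (x t) (velocity A x t) (velocity A x t) + V (x t) = h"
  shows "motion A m V \<kappa> J x \<longleftrightarrow>
    (let m\<^sub>h = jacobi_metric m V h;
         y = by_arclength A m\<^sub>h J x a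
     in \<forall>\<tau> \<in> arclength A m\<^sub>h x a ` J.
          geodesic_curvature A m\<^sub>h y \<tau> = abs_form_ratio A m\<^sub>h \<kappa> (y \<tau>) \<and>
          (nonzero_form_at A \<kappa> (y \<tau>) \<longrightarrow>
             same_orientation \<kappa> (y \<tau>) (curvature_vector A m\<^sub>h y \<tau>) (velocity A y \<tau>)))"
proof -
  interpret constant_energy_curve A m V \<kappa> h a J x
    using assms by unfold_locales (auto simp: gyroscopic_system_def smooth_manifold_def)
  have pts: "x t \<in> points A" if "t \<in> J" for t
    using curve(2) that by (auto simp: energy_region_def)
  define c where "c t = chart_at A (x t)" for t
  have c: "c t \<in> A" "x t \<in> fst (c t)" if "t \<in> J" for t
    using chart_at[OF pts[OF that]] by (simp_all add: c_def)
  \<comment> \<open>Motions are characterized in the charts in which the curvature vectors are computed, so both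
    conditions can be compared at one point.\<close>
  have pointwise: "newton_equation A m V \<kappa> (c t) (snd (c t) (x t)) (velocity A x t (c t)) (acc (c t) t) \<longleftrightarrow>
      geodesic_curvature A mh y (len t) = abs_form_ratio A mh \<kappa> (y (len t)) \<and>
      (nonzero_form_at A \<kappa> (y (len t)) \<longrightarrow>
        same_orientation \<kappa> (y (len t)) (curvature_vector A mh y (len t)) (velocity A y (len t)))"
    if t: "t \<in> J" for t
  proof -
    let ?q = "snd (c t) (x t)" and ?u = "velocity A x t (c t)" and ?f = "jacobi_speed t"
    let ?B = "coord_2tensor A mh (c t) ?q" and ?K = "coord_2tensor A \<kappa> (c t) ?q" and ?E = "coord_vector A (c t) (x t)"
    define v where "v = ?u /\<^sub>R ?f"
    have q: "?q \<in> snd (c t) ` fst (c t)" using c[OF t] by simp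
    have p: "chart_inv (c t) ?q = x t" using chart_inv_snd c[OF t] .
    have f: "?f > 0" using speed_pos[OF t] .
    have E: "\<beta> (x t) (?E u) (?E w) = coord_2tensor A \<beta> (c t) ?q u w" for \<beta> u w
      by (simp add: coord_2tensor_def p)
    have B: "bilinear ?B" using jacobi_metric_bilinear[OF c(1)[OF t] q] .
    have K: "bilinear ?K" "?K w w = 0" for w
      using \<kappa> c[OF t] q coord_vector_in_tangent_space[OF c[OF t], of w] pts[OF t]
      by (auto simp: smooth_closed_2form_def smooth_2tensor_def E[symmetric])
    have sym: "?B u w = ?B w u" for u w
      using metric_symmetric[OF c(1)[OF t] q] by (simp add: jacobi_metric_coords)
    have pos: "?B u u > 0" if "u \<noteq> 0" for u
      using metric_positive[OF c(1)[OF t] q that] f by (simp add: jacobi_metric_coords p)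
    have "?B ?u ?u = ?f * ?f"
      using velocity_squared[OF t] coord_vector_of_tangent_vector[OF c[OF t] velocity_in_tangent_space[OF x(1) t]]
      by (simp add: E[symmetric] jacobi_metric_def)
    then have "?B v v = inverse ?f * (inverse ?f * (?f * ?f))"
      by (simp only: v_def bilinear_lmul[OF B] bilinear_rmul[OF B] real_scaleR_def)
    also have "\<dots> = 1" using f by (rule inverse_square_cancel)
    finally have v: "?B v v = 1" .
    obtain n where n: "?B n n = 1" "?B n v = 0" "\<And>z. z = ?B z n *\<^sub>R n + ?B z v *\<^sub>R v"
      using orthonormal_frame_completion[OF B sym pos v] by blast
    interpret planar_frame ?B n v
      using B sym n v by unfold_locales
    have "?B (curv t) v = 0"
      using curvature_orthogonal[OF t pts[OF t], folded c_def] unfolding v_def bilinear_rmul[OF B] by simp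
    note crit = magnetic_curvature_iff[OF K this]
    have "newton_equation A m V \<kappa> (c t) ?q ?u (acc (c t) t) \<longleftrightarrow> (\<forall>z. ?B (curv t) z = - ?K v z)"
    proof -
      have "\<gamma> = - d - k \<longleftrightarrow> (\<gamma> + d) / r = - (k /\<^sub>R r)" if "r > 0" for \<gamma> d k r :: real
      proof -
        have "\<gamma> = - d - k \<longleftrightarrow> \<gamma> + d = - k" by linarith
        also have "\<dots> \<longleftrightarrow> (\<gamma> + d) / r = - k / r"
          using that divide_cancel_right[of "\<gamma> + d" r "- k"] by (metis less_irrefl)
        also have "- k / r = - (k /\<^sub>R r)" by (simp add: divide_inverse mult.commute)
        finally show ?thesis .
      qed
      from this[OF f] show ?thesis
        unfolding newton_equation_def curvature_pairing[OF t pts[OF t], folded c_def] v_def bilinear_lmul[OF K(1)]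
        by (intro arg_cong[of _ _ All] ext)
    qed
    also have "\<dots> \<longleftrightarrow> sqrt (?B (curv t) (curv t)) = \<bar>?K n v\<bar> \<and> (?K n v \<noteq> 0 \<longrightarrow> ?K (curv t) v > 0)"
      by (rule crit)
    also have "\<dots> \<longleftrightarrow> geodesic_curvature A mh y (len t) = abs_form_ratio A mh \<kappa> (y (len t)) \<and>
      (nonzero_form_at A \<kappa> (y (len t)) \<longrightarrow>
        same_orientation \<kappa> (y (len t)) (curvature_vector A mh y (len t)) (velocity A y (len t)))"
      using abs_form_ratio_eq[OF differentiable_atlas_axioms c[OF t] planar_frame_axioms K]
        curvature_vector_coords[OF t pts[OF t], folded c_def] by_arclength_velocity[OF t c[OF t], folded v_def]
      by (simp add: geodesic_curvature_def metric_norm_def same_orientation_def by_arclength_len[OF t] E)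
    finally show ?thesis .
  qed
  have "motion A m V \<kappa> J x \<longleftrightarrow> (\<forall>t\<in>J.
      newton_equation A m V \<kappa> (c t) (snd (c t) (x t)) (velocity A x t (c t)) (acc (c t) t))"
    using motion_iff_newton[OF x(1), of c] c by blast
  then show ?thesis
    unfolding Let_def using pointwise by simp
qed

end
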